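(* Let $T$ be a zero-mean Gaussian isotropic random field on $S^2$ with angular power spectrum $\{C_\ell\}$, let $\lambda>0$ be the penalization parameter of the complex-valued regularization scheme, let $T^{reg}_\ell$ be the $\ell$-th multipole component of the regularized field, and let $$\kappa_\ell(\theta,\phi):=\frac{E\{T^{reg}_\ell(\theta,\phi)^4\}}{\big(E\{T^{reg}_\ell(0,0)^2\}\big)^2}.$$ Then, as $\lambda/\sqrt{C_\ell}\to\infty$, we have that $$\lim_{\ell\to\infty}\frac{\kappa_\ell(\theta,\phi)}{\kappa_\ell(0,0)\,P_\ell^4(\cos\theta)}=1\quad\text{for all }(\theta,\phi)\in S^2,$$ where $P_\ell$ denotes the usual Legendre polynomial.
   Context: $\{Y_{\ell m}\}_{\ell\ge0,\,-\ell\le m\le\ell}$ denotes the standard complex orthonormal basis of spherical harmonics of $L^2(S^2)$, with $Y_{\ell m}=(-1)^m\overline{Y}_{\ell,-m}$; $(\theta,\phi)$ are spherical coordinates, the North Pole being $(0,0)$. A zero-mean Gaussian isotropic field has the expansion $T=\sum_{\ell}\sum_{m=-\ell}^{\ell}a^{obs}_{\ell m}Y_{\ell m}$, where $a^{obs}_{\ell,-m}=(-1)^m\overline{a^{obs}_{\ell m}}$, the coefficients with $m\ge0$ are independent, $a^{obs}_{\ell0}$ is real centred Gaussian with variance $C_\ell$, and for $m\ne0$ the real and imaginary parts of $a^{obs}_{\ell m}$ are independent centred Gaussians with variance $C_\ell/2$. It is assumed that $0<C_\ell<\infty$ for all $\ell\ge0$ and $C_\ell\le K\ell^{-\alpha}$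 for $\ell\ge 1$, some $K>0$, $\alpha>2$ (so that $C_\ell\to0$ as $\ell\to\infty$). The complex-valued regularization scheme with penalization $\lambda>0$ is $$\{a^{reg}_{\ell m}\}=\arg\min_{\{a_{\ell m}\}}\Big\{\lambda\sum_{\ell m}|a_{\ell m}|+\tfrac12\Big\|T-\sum_{\ell m}a_{\ell m}Y_{\ell m}\Big\|^2_{L^2(S^2)}\Big\},$$ the minimum being over complex arrays, with $|\cdot|$ the complex modulus, for each realization of $T$; and $T^{reg}_\ell=\sum_{m=-\ell}^{\ell}a^{reg}_{\ell m}Y_{\ell m}$.
   Formalization: The limit fails for some (θ,φ): at θ=π/2, P_ℓ(cos θ)=0 for all odd ℓ. It is instead proved for almost every θ and all φ, and for every (θ,φ) along the degrees ℓ with |P_ℓ(cos θ)| ≥ exp(-bℓ²), for any fixed b. *)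

theory Defs
  imports "HOL-Probability.Probability" "HOL-Computational_Algebra.Polynomial"
begin

definition legendre :: "nat \<Rightarrow> real poly" where
  "legendre l = smult (1 / (2 ^ l * fact l)) ((pderiv ^^ l) ([:-1, 0, 1:] ^ l))"

text \<open>Associated Legendre functions for order \<open>m \<ge> 0\<close>, with the Condon-Shortley phase.\<close>

definition assoc_legendre :: "nat \<Rightarrow> nat \<Rightarrow> real \<Rightarrow> real" where
  "assoc_legendre l m x = (-1) ^ m * sqrt (1 - x\<^sup>2) ^ m * poly ((pderiv ^^ m) (legendre l)) x"

definition sph_harm_nonneg :: "nat \<Rightarrow> nat \<Rightarrow> real \<times> real \<Rightarrow> complex" where
  "sph_harm_nonneg l m = (\<lambda>(\<theta>, \<phi>).
     of_real (sqrt ((2 * real l + 1) / (4 * pi) * (fact (l - m) / fact (l + m)))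
              * assoc_legendre l m (cos \<theta>)) * cis (real m * \<phi>))"

text \<open>The spherical harmonic of degree \<open>l\<close> and order \<open>m\<close>, \<open>\<bar>m\<bar> \<le> l\<close>, in spherical
  coordinates \<open>(\<theta>, \<phi>)\<close>.\<close>

definition sph_harm :: "nat \<Rightarrow> int \<Rightarrow> real \<times> real \<Rightarrow> complex" where
  "sph_harm l m p =
     (if 0 \<le> m then sph_harm_nonneg l (nat m) p
      else (-1) ^ nat (- m) * cnj (sph_harm_nonneg l (nat (- m)) p))"

definition sphere_point :: "real \<times> real \<Rightarrow> real ^ 3" where
  "sphere_point = (\<lambda>(\<theta>, \<phi>). vector [sin \<theta> * cos \<phi>, sin \<theta> * sin \<phi>, cos \<theta>])"

text \<open>The surface measure of the unit sphere, written in spherical coordinates.\<close>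

definition sphere_measure :: "(real \<times> real) measure" where
  "sphere_measure = density lborel
     (\<lambda>(\<theta>, \<phi>). ennreal (indicator ({0..pi} \<times> {0..2 * pi}) (\<theta>, \<phi>) * sin \<theta>))"

definition multipole :: "(nat \<Rightarrow> int \<Rightarrow> complex) \<Rightarrow> nat \<Rightarrow> real \<times> real \<Rightarrow> complex" where
  "multipole a l p = (\<Sum>m = - int l..int l. a l m * sph_harm l m p)"

text \<open>Squared distance in \<open>L\<^sup>2\<close> of the sphere between \<open>f\<close> and the \<open>L\<close>-th partial sum of the
  expansion with coefficients \<open>a\<close>.\<close>

definition residual :: "(real ^ 3 \<Rightarrow> real) \<Rightarrow> (nat \<Rightarrow> int \<Rightarrow> complex) \<Rightarrow> nat \<Rightarrow> ennreal" where
  "residual f a L =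
     (\<integral>\<^sup>+ p. ennreal ((cmod (of_real (f (sphere_point p)) - (\<Sum>l\<le>L. multipole a l p)))\<^sup>2)
       \<partial>sphere_measure)"

definition square_integrable_on_sphere :: "(real ^ 3 \<Rightarrow> real) \<Rightarrow> bool" where
  "square_integrable_on_sphere f \<longleftrightarrow>
     f \<in> borel_measurable (restrict_space borel (sphere 0 1)) \<and>
     (\<integral>\<^sup>+ p. ennreal ((f (sphere_point p))\<^sup>2) \<partial>sphere_measure) < \<infinity>"

text \<open>Only the entries \<open>a l m\<close> with \<open>\<bar>m\<bar> \<le> l\<close> of an array matter. For square-summable arrays
  the lower limit below is the limit, namely the squared norm of \<open>f - \<Sum> a l m Y l m\<close>; for all other
  arrays the penalty is infinite.\<close>

definition reg_objective ::
  "real \<Rightarrow> (real ^ 3 \<Rightarrow> real) \<Rightarrow> (nat \<Rightarrow> int \<Rightarrow> complex) \<Rightarrow> ennreal" where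
  "reg_objective lam f a =
     ennreal lam * (\<Sum>l. \<Sum>m = - int l..int l. ennreal (cmod (a l m)))
     + ennreal (1 / 2) * liminf (residual f a)"

definition reg_coeffs :: "real \<Rightarrow> (real ^ 3 \<Rightarrow> real) \<Rightarrow> nat \<Rightarrow> int \<Rightarrow> complex" where
  "reg_coeffs lam f = arg_min (reg_objective lam f) (\<lambda>_. True)"

definition reg_multipole ::
  "real \<Rightarrow> ('w \<Rightarrow> real ^ 3 \<Rightarrow> real) \<Rightarrow> nat \<Rightarrow> real \<times> real \<Rightarrow> 'w \<Rightarrow> complex" where
  "reg_multipole lam T l p \<omega> = multipole (reg_coeffs lam (T \<omega>)) l p"

text \<open>Joint law of the random spherical harmonic coefficients of a zero-mean Gaussian isotropic
  real field with angular power spectrum \<open>C\<close>. The symmetry at \<open>m = 0\<close> says that the coefficient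
  is real. The second argument of \<open>normal_density\<close> is the standard deviation, not the
  variance.\<close>

definition gaussian_isotropic_coeffs ::
  "'w measure \<Rightarrow> (nat \<Rightarrow> real) \<Rightarrow> (nat \<Rightarrow> int \<Rightarrow> 'w \<Rightarrow> complex) \<Rightarrow> bool" where
  "gaussian_isotropic_coeffs M C a \<longleftrightarrow>
     (\<forall>l m. \<bar>m\<bar> \<le> int l \<longrightarrow> a l m \<in> borel_measurable M) \<and>
     (\<forall>l m. \<bar>m\<bar> \<le> int l \<longrightarrow> (AE \<omega> in M. a l (- m) \<omega> = (-1) ^ nat \<bar>m\<bar> * cnj (a l m \<omega>))) \<and>
     prob_space.indep_vars M (\<lambda>_. borel) (\<lambda>(l, m). a l m) {(l, m). 0 \<le> m \<and> m \<le> int l} \<and>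
     (\<forall>l. distributed M lborel (\<lambda>\<omega>. Re (a l 0 \<omega>)) (normal_density 0 (sqrt (C l)))) \<and>
     (\<forall>l m. m \<noteq> 0 \<and> \<bar>m\<bar> \<le> int l \<longrightarrow>
        distributed M lborel (\<lambda>\<omega>. Re (a l m \<omega>)) (normal_density 0 (sqrt (C l / 2))) \<and>
        distributed M lborel (\<lambda>\<omega>. Im (a l m \<omega>)) (normal_density 0 (sqrt (C l / 2))) \<and>
        prob_space.indep_var M borel (\<lambda>\<omega>. Re (a l m \<omega>)) borel (\<lambda>\<omega>. Im (a l m \<omega>)))"

text \<open>A zero-mean Gaussian isotropic field is described by its spherical harmonic expansion,
  which converges in \<open>L\<^sup>2\<close> of the sphere for almost every realization.\<close>

definition gaussian_isotropic_field ::
  "'w measure \<Rightarrow> (nat \<Rightarrow> real) \<Rightarrow> ('w \<Rightarrow> real ^ 3 \<Rightarrow> real) \<Rightarrow> bool" where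
  "gaussian_isotropic_field M C T \<longleftrightarrow>
     prob_space M \<and>
     (\<lambda>(\<omega>, x). T \<omega> x) \<in> borel_measurable (M \<Otimes>\<^sub>M restrict_space borel (sphere 0 1)) \<and>
     (\<forall>\<omega>\<in>space M. square_integrable_on_sphere (T \<omega>)) \<and>
     (\<exists>a. gaussian_isotropic_coeffs M C a \<and>
          (AE \<omega> in M. residual (T \<omega>) (\<lambda>l m. a l m \<omega>) \<longlonglongrightarrow> 0))"

definition kappa ::
  "'w measure \<Rightarrow> real \<Rightarrow> ('w \<Rightarrow> real ^ 3 \<Rightarrow> real) \<Rightarrow> nat \<Rightarrow> real \<times> real \<Rightarrow> complex" where
  "kappa M lam T l p =
     (\<integral>\<omega>. reg_multipole lam T l p \<omega> ^ 4 \<partial>M) /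
     (\<integral>\<omega>. reg_multipole lam T l (0, 0) \<omega> ^ 2 \<partial>M)\<^sup>2"

definition kappa_ratio ::
  "'w measure \<Rightarrow> real \<Rightarrow> ('w \<Rightarrow> real ^ 3 \<Rightarrow> real) \<Rightarrow> real \<times> real \<Rightarrow> nat \<Rightarrow> complex" where
  "kappa_ratio M lam T = (\<lambda>(\<theta>, \<phi>) l.
     kappa M lam T l (\<theta>, \<phi>) /
     (kappa M lam T l (0, 0) * of_real (poly (legendre l) (cos \<theta>) ^ 4)))"

text \<open>The degrees at which \<open>P\<^sub>l(cos \<theta>)\<close> is neither zero nor super-exponentially small. At the
  other degrees \<open>kappa_ratio\<close> has a (nearly) vanishing denominator, while its numerator
  keeps the positive contribution of the orders \<open>m \<noteq> 0\<close>. For example, \<open>P\<^sub>l(cos (pi / 2)) = 0\<close> for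
  all odd \<open>l\<close>, and since the zeros of the \<open>P\<^sub>l\<close> are dense there are (Baire) angles with all
  \<open>P\<^sub>l(cos \<theta>) \<noteq> 0\<close> at which \<open>kappa_ratio\<close> is unbounded. Such angles form a null set.\<close>

definition regular_degrees :: "real \<Rightarrow> real \<Rightarrow> nat set" where
  "regular_degrees b \<theta> = {l. exp (- b * real l ^ 2) \<le> \<bar>poly (legendre l) (cos \<theta>)\<bar>}"

end

theory Submission
  imports Defs "HOL-Computational_Algebra.Fundamental_Theorem_Algebra"
begin

text \<open>Since the spherical harmonics are orthonormal, the regularization decouples and its
  minimizer is coefficientwise soft thresholding at level \<open>\<lambda>\<close>. Hence \<open>T\<^sub>l\<close> at a point is \<open>U + W\<close>, where
  \<open>U\<close> is the order \<open>m = 0\<close> term, proportional to \<open>P\<^sub>l(cos \<theta>)\<close>, and \<open>W\<close> collects the orders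
  \<open>m \<noteq> 0\<close> and vanishes at the pole. With \<open>s = \<lambda> / sqrt C\<^sub>l\<close>, a real coefficient of variance \<open>C\<^sub>l\<close> exceeds
  the threshold with probability about \<open>exp (- s\<^sup>2 / 2)\<close>, but the modulus of a complex one only with probability
  \<open>exp (- s\<^sup>2)\<close>. So \<open>E W\<^sup>4 / E U\<^sup>4\<close> is at most \<open>exp (O(l\<^sup>2) - s\<^sup>2 / 10) / P\<^sub>l(cos \<theta>)\<^sup>4\<close>, and
  \<open>s\<^sup>2\<close> grows like \<open>l\<^sup>\<alpha>\<close> with \<open>\<alpha> > 2\<close>; this forces \<open>E (U + W)\<^sup>4 / E U\<^sup>4 \<rightarrow> 1\<close>.
  For almost every \<open>\<theta>\<close> all large degrees are regular, by Borel-Cantelli: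
  a polynomial of degree \<open>l\<close> with leading coefficient at least 1 is below \<open>\<delta>\<^sup>l\<close> only on a set of
  measure at most \<open>2 l \<delta>\<close>.\<close>

subsection \<open>Legendre polynomials and integration over the polar angle\<close>

text \<open>Neither tail is computed exactly. The complex one is bounded through an exponential
  moment of |z|^2 / C at rate 3/4, below the critical rate 1; of this, 1/20 pays for the fourth
  power, which leaves 7/10. The real tail is bounded below by exp(-(s + 2)^2 / 2). Half of the
  margin 7/10 - 1/2 = 1/5 is spent on the cross term 2 s, and the other half is the 1/10 of the
  overview. All other estimates may lose a factor exp(O(l^2)), because s^2 is at least lam^2
  l^\<alpha> / K. This is why the spherical harmonics can be bounded by sums of absolute
  coefficients, and why P_l may be as small as exp(- b l^2).

  The minimizer needs care: \<open>reg_coeffs\<close> is a choice among minimizers over all arrays,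
  including arrays of infinite objective. Soft thresholding is therefore shown to minimize with a
  quadratic excess. That determines every minimizer at |m| \<le> l, and the resulting formula gives
  measurability in the realization.\<close>

definition cos_integral :: "real poly \<Rightarrow> real" where
  "cos_integral q = (\<integral>x. (poly q (cos x) * sin x) * indicator {0..pi} x \<partial>lborel)"

lemma integrable_cos_integral:
  "integrable lborel (\<lambda>x. (poly q (cos x) * sin x) * indicator {0..pi} x)"
proof -
  have "continuous_on {0..pi} (\<lambda>x. poly q (cos x) * sin x)"
    by (intro continuous_intros)
  from borel_integrable_atLeastAtMost'[OF this] show ?thesis
    unfolding set_integrable_def by (simp add: mult.commute)
qed

lemma cos_integral_add: "cos_integral (p + q) = cos_integral p + cos_integral q"
  unfolding cos_integral_def
  by (subst Bochner_Integration.integral_add[OF integrable_cos_integral integrable_cos_integral, symmetric])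
    (simp add: algebra_simps)

lemma cos_integral_smult: "cos_integral (smult c p) = c * cos_integral p"
  unfolding cos_integral_def
  by (subst integral_mult_right_zero[symmetric]) (simp add: mult.assoc)

text \<open>With t = cos x, \<open>cos_integral\<close> is integration over [-1,1] in t. Keeping the
  angle as variable matches the polar factor of \<open>sphere_measure\<close>, and the
  antiderivative -q(cos x) makes a change of variables unnecessary.\<close>

lemma cos_integral_pderiv: "cos_integral (pderiv q) = poly q 1 - poly q (-1)"
proof -
  have "(\<integral>x. (poly (pderiv q) (cos x) * sin x) * indicator {0..pi} x \<partial>lborel)
      = (- poly q (cos pi)) - (- poly q (cos 0))"
  proof (rule integral_FTC_Icc_real)
    show "DERIV (\<lambda>x. - poly q (cos x)) x :> poly (pderiv q) (cos x) * sin x" for x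
      by (auto intro!: derivative_eq_intros)
    show "isCont (\<lambda>x. poly (pderiv q) (cos x) * sin x) x" for x
      by (intro continuous_intros)
  qed simp
  then show ?thesis by (simp add: cos_integral_def)
qed

lemma cos_integral_by_parts:
  "cos_integral (pderiv p * q) = poly (p * q) 1 - poly (p * q) (-1) - cos_integral (p * pderiv q)"
  using cos_integral_pderiv[of "p * q"]
  by (simp add: pderiv_mult cos_integral_add mult.commute)

abbreviation (input) wpoly :: "real poly" where "wpoly \<equiv> [:-1, 0, 1:]"

lemma wpoly_dvd_pderiv:
  assumes "wpoly ^ Suc n dvd g"
  shows "wpoly ^ n dvd pderiv g"
proof -
  obtain r where "g = wpoly ^ Suc n * r" using assms by blast
  then have "pderiv g = wpoly ^ n * (wpoly * pderiv r + smult (of_nat (Suc n)) (pderiv wpoly * r))"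
    by (simp only: pderiv_mult pderiv_power_Suc) (simp add: algebra_simps)
  then show ?thesis by (rule dvdI)
qed

text \<open>Each integration by parts costs one factor t^2 - 1, so divisibility by the n-th power
  makes all n boundary terms at 1 and -1 vanish.\<close>

lemma cos_integral_iterated_by_parts:
  assumes "wpoly ^ n dvd g"
  shows "cos_integral ((pderiv ^^ n) g * q) = (-1) ^ n * cos_integral (g * (pderiv ^^ n) q)"
  using assms
proof (induction n arbitrary: g)
  case 0 then show ?case by simp
next
  case (Suc n)
  obtain r where "g = wpoly ^ Suc n * r" using Suc.prems by blast
  then have 0: "poly g 1 = 0" "poly g (-1) = 0" by simp_all
  have "cos_integral ((pderiv ^^ Suc n) g * q) = cos_integral ((pderiv ^^ n) (pderiv g) * q)"
    by (simp add: funpow_swap1)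
  also have "\<dots> = (-1) ^ n * cos_integral (pderiv g * (pderiv ^^ n) q)"
    by (rule Suc.IH[OF wpoly_dvd_pderiv[OF Suc.prems]])
  also have "\<dots> = (-1) ^ Suc n * cos_integral (g * (pderiv ^^ Suc n) q)"
    by (simp add: cos_integral_by_parts 0)
  finally show ?case .
qed

lemma cos_integral_wpoly_power:
  "(-1) ^ n * cos_integral (wpoly ^ n) = 2 ^ (2 * n + 1) * (fact n)\<^sup>2 / fact (2 * n + 1)"
proof (induction n)
  case 0
  show ?case using cos_integral_pderiv[of "[:0, 1:]"] by (simp add: pderiv_pCons one_pCons)
next
  case (Suc n)
  define I where "I k = cos_integral (wpoly ^ k)" for k
  \<comment> \<open>The factor 1 is written as the derivative of t, to integrate by parts.\<close>
  have "I (Suc n) = cos_integral (pderiv [:0, 1:] * wpoly ^ Suc n)"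
    by (simp add: I_def pderiv_pCons)
  also have "\<dots> = - cos_integral ([:0, 1:] * pderiv (wpoly ^ Suc n))"
    by (subst cos_integral_by_parts) simp
  \<comment> \<open>Differentiation produces t^2 (t^2 - 1)^n, and t^2 = (t^2 - 1) + 1 returns it to
    the same family, giving a two-term recurrence.\<close>
  also have "[:0, 1:] * pderiv (wpoly ^ Suc n) = smult (2 * (real n + 1)) (wpoly ^ Suc n + wpoly ^ n)"
    by (simp only: pderiv_power_Suc) (simp add: pderiv_pCons algebra_simps smult_add_left)
  finally have "I (Suc n) = - (2 * (real n + 1)) * (I (Suc n) + I n)"
    by (simp only: cos_integral_smult cos_integral_add I_def)
  then have "(2 * real n + 3) * I (Suc n) = - ((2 * real n + 2) * I n)"
    by (simp add: algebra_simps)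
  then have r: "I (Suc n) = - ((2 * real n + 2) * I n) / (2 * real n + 3)"
    by (simp add: field_simps)
  have "(-1) ^ Suc n * I (Suc n) = (2 * real n + 2) / (2 * real n + 3) * ((-1) ^ n * I n)"
    by (simp add: r)
  also have "\<dots> = (2 * real n + 2) / (2 * real n + 3) * (2 ^ (2 * n + 1) * (fact n)\<^sup>2 / fact (2 * n + 1))"
    using Suc.IH by (simp add: I_def)
  also have "\<dots> = 2 ^ (2 * Suc n + 1) * (fact (Suc n))\<^sup>2 / fact (2 * Suc n + 1)"
    by (simp add: divide_simps power2_eq_square) algebra
  finally show ?case by (simp add: I_def)
qed

lemma degree_wpoly_power: "degree (wpoly ^ n) = 2 * n"
  by (simp add: degree_power_eq)

lemma coeff_wpoly_power: "coeff (wpoly ^ n) (2 * n) = 1"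
  using lead_coeff_power[of wpoly n] by (simp add: degree_wpoly_power)

lemma pochhammer_Suc_eq_fact: "pochhammer (real (Suc a)) b = fact (a + b) / fact a"
proof (induction b)
  case (Suc b)
  have "pochhammer (real (Suc a)) (Suc b) = pochhammer (real (Suc a)) b * real (Suc (a + b))"
    by (simp add: pochhammer_Suc)
  also have "\<dots> = fact (a + Suc b) / fact a"
    by (simp only: Suc.IH) simp
  finally show ?case .
qed simp

lemma degree_legendre: "degree (legendre l) = l"
  by (simp add: legendre_def degree_higher_pderiv degree_wpoly_power)

lemma coeff_legendre: "coeff (legendre l) l = fact (2 * l) / (2 ^ l * (fact l)\<^sup>2)"
proof -
  have "coeff (legendre l) l = 1 / (2 ^ l * fact l) * (pochhammer (real (Suc l)) l * coeff (wpoly ^ l) (2 * l))"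
    by (simp add: legendre_def coeff_higher_pderiv mult_2)
  then show ?thesis
    unfolding coeff_wpoly_power pochhammer_Suc_eq_fact by (simp add: mult_2 power2_eq_square)
qed

text \<open>By Rodrigues' formula, l integrations by parts move all derivatives to \<open>q\<close>,
  whose l-th derivative is the constant l! times its coefficient at l. Orthogonality to lower
  degrees and the norm of P_l are both special cases.\<close>

lemma cos_integral_legendre_mult:
  assumes "degree q \<le> l"
  shows "cos_integral (legendre l * q) = coeff q l * (2 ^ (l + 1) * (fact l)\<^sup>2 / fact (2 * l + 1))"
proof -
  have c: "(pderiv ^^ l) q = [:fact l * coeff q l:]"
  proof (rule poly_eqI)
    fix n
    show "coeff ((pderiv ^^ l) q) n = coeff [:fact l * coeff q l:] n"
      using assms by (cases n) (auto simp: coeff_higher_pderiv pochhammer_fact coeff_eq_0)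
  qed
  have "cos_integral (legendre l * q) = 1 / (2 ^ l * fact l) * cos_integral ((pderiv ^^ l) (wpoly ^ l) * q)"
    by (simp add: legendre_def cos_integral_smult)
  also have "\<dots> = 1 / (2 ^ l * fact l) * ((-1) ^ l * cos_integral (smult (fact l * coeff q l) (wpoly ^ l)))"
    by (simp add: cos_integral_iterated_by_parts c)
  also have "\<dots> = 1 / (2 ^ l) * coeff q l * ((-1) ^ l * cos_integral (wpoly ^ l))"
    by (simp add: cos_integral_smult)
  also have "\<dots> = coeff q l * (2 ^ (l + 1) * (fact l)\<^sup>2 / fact (2 * l + 1))"
  proof -
    have "(2::real) ^ (2 * l + 1) = 2 ^ l * 2 ^ (l + 1)"
      by (subst power_add[symmetric], rule arg_cong[of _ _ "power 2"]) simp
    then show ?thesis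
      by (simp only: cos_integral_wpoly_power times_divide_eq_right times_divide_eq_left mult_1_left) simp
  qed
  finally show ?thesis .
qed

text \<open>Integrating by parts m times moves the derivatives from P_l to g = (t^2 - 1)^m times the
  m-th derivative of P_l'. The result pairs P_l with a polynomial of degree at most l' \<le> l, so
  only its coefficient at l counts; it is zero unless l = l'.\<close>

lemma cos_integral_assoc_legendre_le:
  assumes "m \<le> l'" "l' \<le> l"
  shows "cos_integral ((- wpoly) ^ m * (pderiv ^^ m) (legendre l) * (pderiv ^^ m) (legendre l'))
    = (if l = l' then 2 / (2 * real l + 1) * (fact (l + m) / fact (l - m)) else 0)"
proof -
  define g where "g = wpoly ^ m * (pderiv ^^ m) (legendre l')"
  define h where "h = (pderiv ^^ m) (legendre l')"
  have dh: "degree h = l' - m" by (simp add: h_def degree_higher_pderiv degree_legendre)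
  have dg: "degree g \<le> l' + m"
  proof -
    have "degree g \<le> degree (wpoly ^ m) + degree h" unfolding g_def h_def by (rule degree_mult_le)
    with assms show ?thesis by (simp only: degree_wpoly_power dh)
  qed
  have cg: "coeff g (l' + m) = coeff h (l' - m)"
  proof -
    have "coeff (wpoly ^ m * h) (degree (wpoly ^ m) + degree h)
        = lead_coeff (wpoly ^ m) * lead_coeff h"
      by (rule coeff_mult_degree_sum)
    moreover have "degree (wpoly ^ m) + degree h = l' + m"
      using assms by (simp only: degree_wpoly_power dh)
    moreover have "lead_coeff (wpoly ^ m) = 1"
      by (simp only: degree_wpoly_power coeff_wpoly_power)
    ultimately show ?thesis by (simp add: g_def h_def[symmetric] dh)
  qed
  have ddg: "degree ((pderiv ^^ m) g) \<le> l"
    using dg assms by (simp add: degree_higher_pderiv)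
  have "(- wpoly) ^ m * (pderiv ^^ m) (legendre l) * (pderiv ^^ m) (legendre l')
      = smult ((-1) ^ m) (g * (pderiv ^^ m) (legendre l))"
    unfolding g_def by (subst power_minus) (simp add: algebra_simps minus_one_power_iff)
  then have "cos_integral ((- wpoly) ^ m * (pderiv ^^ m) (legendre l) * (pderiv ^^ m) (legendre l'))
      = (-1) ^ m * cos_integral (g * (pderiv ^^ m) (legendre l))"
    by (simp only: cos_integral_smult)
  also have "\<dots> = cos_integral ((pderiv ^^ m) g * legendre l)"
    by (subst cos_integral_iterated_by_parts) (simp_all add: g_def)
  also have "\<dots> = coeff ((pderiv ^^ m) g) l * (2 ^ (l + 1) * (fact l)\<^sup>2 / fact (2 * l + 1))"
    using cos_integral_legendre_mult[OF ddg] by (simp only: mult.commute)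
  also have "coeff ((pderiv ^^ m) g) l = (fact (l + m) / fact l) * coeff g (l + m)"
    by (simp add: coeff_higher_pderiv pochhammer_Suc_eq_fact del: of_nat_Suc)
  finally have main: "cos_integral ((- wpoly) ^ m * (pderiv ^^ m) (legendre l) * (pderiv ^^ m) (legendre l'))
     = (fact (l + m) / fact l) * coeff g (l + m) * (2 ^ (l + 1) * (fact l)\<^sup>2 / fact (2 * l + 1))" .
  show ?thesis
  proof (cases "l = l'")
    case True
    have "coeff h (l - m) = fact l / fact (l - m) * coeff (legendre l) l"
      using assms True
      by (simp add: h_def coeff_higher_pderiv pochhammer_Suc_eq_fact del: of_nat_Suc)
    then have "coeff g (l + m) = fact l / fact (l - m) * (fact (2 * l) / (2 ^ l * (fact l)\<^sup>2))"
      using cg True by (simp add: coeff_legendre)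
    moreover have "fact (2 * l + 1) = (2 * real l + 1) * fact (2 * l)" by simp
    ultimately have "(fact (l + m) / fact l) * coeff g (l + m) * (2 ^ (l + 1) * (fact l)\<^sup>2 / fact (2 * l + 1))
        = 2 / (2 * real l + 1) * (fact (l + m) / fact (l - m))"
      by (simp only: power_add) (simp add: mult.commute)
    with main True show ?thesis by simp
  next
    case False
    then have "coeff g (l + m) = 0" using dg assms by (intro coeff_eq_0) simp
    with main False show ?thesis by simp
  qed
qed

lemma cos_integral_assoc_legendre:
  assumes "m \<le> l" "m \<le> l'"
  shows "cos_integral ((- wpoly) ^ m * (pderiv ^^ m) (legendre l) * (pderiv ^^ m) (legendre l'))
    = (if l = l' then 2 / (2 * real l + 1) * (fact (l + m) / fact (l - m)) else 0)"
proof (cases "l' \<le> l")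
  case True then show ?thesis using cos_integral_assoc_legendre_le assms by blast
next
  case False
  then show ?thesis using cos_integral_assoc_legendre_le[of m l l'] assms
    by (simp add: mult_ac)
qed

text \<open>By the Leibniz rule, only the term in which all derivatives fall on the power survives
  at \<open>a\<close>. The induction is over all cofactors \<open>r\<close>, since one derivative
  gives the next lower power with a new cofactor.\<close>

lemma poly_higher_pderiv_factor_at_root:
  fixes r :: "'a :: field_char_0 poly"
  shows "poly ((pderiv ^^ n) ([:-a, 1:] ^ n * r)) a = fact n * poly r a"
proof (induction n arbitrary: r)
  case (Suc n)
  have "pderiv ([:-a, 1:] ^ Suc n * r)
      = [:-a, 1:] ^ n * (smult (of_nat (Suc n)) r + [:-a, 1:] * pderiv r)"
    by (simp only: pderiv_mult pderiv_power_Suc) (simp add: pderiv_pCons algebra_simps)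
  then have "(pderiv ^^ Suc n) ([:-a, 1:] ^ Suc n * r)
      = (pderiv ^^ n) ([:-a, 1:] ^ n * (smult (of_nat (Suc n)) r + [:-a, 1:] * pderiv r))"
    by (simp only: funpow_Suc_right o_apply)
  then have "poly ((pderiv ^^ Suc n) ([:-a, 1:] ^ Suc n * r)) a
      = fact n * poly (smult (of_nat (Suc n)) r + [:-a, 1:] * pderiv r) a"
    by (simp only: Suc.IH)
  then show ?case by (simp add: algebra_simps)
qed simp

lemma poly_legendre_1: "poly (legendre l) 1 = 1"
proof -
  have "wpoly ^ l = [:-1, 1:] ^ l * [:1, 1:] ^ l"
    by (simp flip: power_mult_distrib)
  then show ?thesis
    by (simp only: legendre_def poly_smult poly_higher_pderiv_factor_at_root) simp
qed

text \<open>Going from l to l + 1 multiplies this coefficient by (2l + 1) / (l + 1). The bound lets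
  |P_l| be estimated below by the product of the distances to its roots.\<close>

lemma coeff_legendre_ge_1: "1 \<le> coeff (legendre l) l"
proof -
  have "(2::real) ^ l * (fact l)\<^sup>2 \<le> fact (2 * l)"
  proof (induction l)
    case (Suc l)
    have "(2::real) ^ Suc l * (fact (Suc l))\<^sup>2 = 2 * (real l + 1)\<^sup>2 * (2 ^ l * (fact l)\<^sup>2)"
      by (simp add: power2_eq_square algebra_simps)
    also have "\<dots> \<le> ((2 * real l + 2) * (2 * real l + 1)) * fact (2 * l)"
      by (rule mult_mono[OF _ Suc.IH]) (auto simp: power2_eq_square algebra_simps)
    also have "\<dots> = fact (2 * Suc l)" by (simp add: algebra_simps)
    finally show ?case .
  qed simp
  then show ?thesis by (simp add: coeff_legendre)
qed

section \<open>Crude bounds for the derivatives of Legendre polynomials on [-1,1]\<close>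

definition coeff_norm :: "real poly \<Rightarrow> real" where
  "coeff_norm p = (\<Sum>i\<le>degree p. \<bar>coeff p i\<bar>)"

lemma coeff_norm_nonneg: "0 \<le> coeff_norm p"
  by (simp add: coeff_norm_def sum_nonneg)

lemma coeff_norm_altdef:
  assumes "degree p \<le> n"
  shows "coeff_norm p = (\<Sum>i\<le>n. \<bar>coeff p i\<bar>)"
  unfolding coeff_norm_def using assms
  by (intro sum.mono_neutral_left) (auto simp: coeff_eq_0)

lemma abs_poly_le_coeff_norm:
  assumes "\<bar>x\<bar> \<le> 1"
  shows "\<bar>poly p x\<bar> \<le> coeff_norm p"
proof -
  have "\<bar>poly p x\<bar> \<le> (\<Sum>i\<le>degree p. \<bar>coeff p i * x ^ i\<bar>)"
    unfolding poly_altdef by (rule sum_abs)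
  also have "\<dots> \<le> coeff_norm p"
    unfolding coeff_norm_def
    using assms by (intro sum_mono) (simp add: abs_mult power_abs mult_left_le power_le_one)
  finally show ?thesis .
qed

lemma coeff_norm_pderiv: "coeff_norm (pderiv p) \<le> real (degree p) * coeff_norm p"
proof (cases "degree p")
  case 0
  then have "pderiv p = 0" by (simp add: pderiv_eq_0_iff)
  then show ?thesis by (simp add: coeff_norm_def)
next
  case (Suc n)
  have "coeff_norm (pderiv p) = (\<Sum>i\<le>n. \<bar>coeff (pderiv p) i\<bar>)"
    by (rule coeff_norm_altdef) (simp add: degree_pderiv Suc)
  also have "\<dots> \<le> (\<Sum>i\<le>n. real (degree p) * \<bar>coeff p (Suc i)\<bar>)"
    using Suc by (intro sum_mono) (auto simp: coeff_pderiv abs_mult intro!: mult_right_mono)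
  also have "\<dots> \<le> real (degree p) * (\<bar>coeff p 0\<bar> + (\<Sum>i\<le>n. \<bar>coeff p (Suc i)\<bar>))"
    by (simp add: sum_distrib_left algebra_simps)
  also have "\<dots> = real (degree p) * coeff_norm p"
    unfolding coeff_norm_def Suc by (simp only: sum.atMost_Suc_shift)
  finally show ?thesis .
qed

lemma coeff_norm_higher_pderiv: "coeff_norm ((pderiv ^^ n) p) \<le> real (degree p) ^ n * coeff_norm p"
proof (induction n)
  case (Suc n)
  have "coeff_norm ((pderiv ^^ Suc n) p) \<le> real (degree ((pderiv ^^ n) p)) * coeff_norm ((pderiv ^^ n) p)"
    using coeff_norm_pderiv by simp
  also have "\<dots> \<le> real (degree p) * (real (degree p) ^ n * coeff_norm p)"
    by (intro mult_mono Suc.IH) (auto simp: degree_higher_pderiv coeff_norm_nonneg)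
  finally show ?case by (simp add: mult.assoc)
qed simp

lemma coeff_norm_smult: "coeff_norm (smult c p) = \<bar>c\<bar> * coeff_norm p"
  by (simp add: coeff_norm_altdef[of _ "degree p"] degree_smult_le abs_mult sum_distrib_left)

lemma coeff_norm_wpoly_mult: "coeff_norm (wpoly * p) \<le> 2 * coeff_norm p"
proof -
  have c: "coeff (wpoly * p) i = (if 2 \<le> i then coeff p (i - 2) else 0) - coeff p i" for i
    by (auto simp: numeral_2_eq_2 coeff_pCons split: nat.splits)
  have "degree (wpoly * p) \<le> degree p + 2"
    using degree_mult_le[of wpoly p] by simp
  then have "coeff_norm (wpoly * p) = (\<Sum>i\<le>degree p + 2. \<bar>coeff (wpoly * p) i\<bar>)"
    by (rule coeff_norm_altdef)
  also have "\<dots> \<le> (\<Sum>i\<le>degree p + 2. (if 2 \<le> i then \<bar>coeff p (i - 2)\<bar> else 0) + \<bar>coeff p i\<bar>)"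
    unfolding c by (intro sum_mono) (simp add: abs_triangle_ineq4 del: coeff_pCons)
  also have "\<dots> = (\<Sum>i\<le>degree p + 2. (if 2 \<le> i then \<bar>coeff p (i - 2)\<bar> else 0)) + coeff_norm p"
    by (simp only: sum.distrib coeff_norm_altdef[of p "degree p + 2"])
  also have "(\<Sum>i\<le>degree p + 2. (if 2 \<le> i then \<bar>coeff p (i - 2)\<bar> else 0)) = coeff_norm p"
    by (simp add: sum.atMost_Suc_shift numeral_2_eq_2 coeff_norm_def del: sum.atMost_Suc)
  finally show ?thesis by simp
qed

lemma coeff_norm_wpoly_power: "coeff_norm (wpoly ^ n) \<le> 2 ^ n"
proof (induction n)
  case (Suc n)
  have "coeff_norm (wpoly ^ Suc n) \<le> 2 * coeff_norm (wpoly ^ n)"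
    using coeff_norm_wpoly_mult[of "wpoly ^ n"] by (simp only: power_Suc)
  with Suc show ?case by simp
qed (simp add: coeff_norm_def)

text \<open>At most 2l derivatives are applied to (t^2 - 1)^l, each costing at most its degree 2l.
  The initial norm 2^l cancels against Rodrigues' 2^l, and the division by l! is given away.\<close>

lemma coeff_norm_legendre_pderiv:
  assumes "m \<le> l"
  shows "coeff_norm ((pderiv ^^ m) (legendre l)) \<le> real (2 * l) ^ (2 * l)"
proof (cases "l = 0")
  \<comment> \<open>Here the bound is \<open>0 ^ 0 = 1\<close>; it is treated apart because
    \<open>power_increasing\<close> needs a base of at least 1.\<close>
  case True with assms show ?thesis by (simp add: legendre_def coeff_norm_def)
next
  case False
  have "(pderiv ^^ m) (legendre l) = smult (1 / (2 ^ l * fact l)) ((pderiv ^^ (m + l)) (wpoly ^ l))"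
    by (simp add: legendre_def higher_pderiv_smult funpow_add)
  then have "coeff_norm ((pderiv ^^ m) (legendre l))
      = 1 / (2 ^ l * fact l) * coeff_norm ((pderiv ^^ (m + l)) (wpoly ^ l))"
    by (simp only: coeff_norm_smult) simp
  also have "\<dots> \<le> 1 / (2 ^ l * fact l) * (real (2 * l) ^ (m + l) * 2 ^ l)"
  proof (intro mult_left_mono)
    show "coeff_norm ((pderiv ^^ (m + l)) (wpoly ^ l)) \<le> real (2 * l) ^ (m + l) * 2 ^ l"
      using coeff_norm_higher_pderiv[of "m + l" "wpoly ^ l"] unfolding degree_wpoly_power
      by (rule order_trans) (intro mult_left_mono coeff_norm_wpoly_power, simp)
  qed simp
  also have "\<dots> = real (2 * l) ^ (m + l) / fact l" by simp
  also have "\<dots> \<le> real (2 * l) ^ (m + l)"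
    using divide_left_mono[of 1 "fact l" "real (2 * l) ^ (m + l)"] by (simp add: fact_ge_1)
  also have "\<dots> \<le> real (2 * l) ^ (2 * l)"
    using False assms by (intro power_increasing) auto
  finally show ?thesis .
qed

subsection \<open>Orthonormality of the spherical harmonics\<close>

definition sph_norm :: "nat \<Rightarrow> real" where
  "sph_norm l = sqrt ((2 * real l + 1) / (4 * pi))"

lemma sph_norm_pos: "0 < sph_norm l"
  by (simp add: sph_norm_def field_simps)

text \<open>The real polar factor, in one formula for both signs of the order, so that products of
  harmonics separate into a polar and an azimuthal integral.\<close>

definition sph_amp :: "nat \<Rightarrow> int \<Rightarrow> real \<Rightarrow> real" where
  "sph_amp l m \<theta> = (if 0 \<le> m then 1 else (-1) ^ nat \<bar>m\<bar>) *
     sqrt ((2 * real l + 1) / (4 * pi) * (fact (l - nat \<bar>m\<bar>) / fact (l + nat \<bar>m\<bar>)))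
       * assoc_legendre l (nat \<bar>m\<bar>) (cos \<theta>)"

lemma sph_harm_eq: "sph_harm l m (\<theta>, \<phi>) = of_real (sph_amp l m \<theta>) * cis (real_of_int m * \<phi>)"
  by (cases "0 \<le> m") (simp_all add: sph_harm_def sph_harm_nonneg_def sph_amp_def cis_cnj)

lemma sph_harm_uminus: "sph_harm l (- m) p = (-1) ^ nat \<bar>m\<bar> * cnj (sph_harm l m p)"
proof -
  have "(-1 :: complex) ^ n * ((-1) ^ n * z) = z" for n z
    by (simp flip: mult.assoc power_add add: mult_2[symmetric])
  then show ?thesis by (cases "m = 0") (auto simp: sph_harm_def sph_harm_nonneg_def split: prod.splits)
qed

lemma sph_harm_0: "sph_harm l 0 (\<theta>, \<phi>) = of_real (sph_norm l * poly (legendre l) (cos \<theta>))"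
  by (simp add: sph_harm_eq sph_amp_def sph_norm_def assoc_legendre_def)

lemma sph_harm_north_pole:
  assumes "m \<noteq> 0"
  shows "sph_harm l m (0, 0) = 0"
  using assms by (simp add: sph_harm_eq sph_amp_def assoc_legendre_def)

lemma abs_assoc_legendre_le:
  assumes "m \<le> l" "\<bar>x\<bar> \<le> 1"
  shows "\<bar>assoc_legendre l m x\<bar> \<le> real (2 * l) ^ (2 * l)"
proof -
  have "x\<^sup>2 \<le> 1" using assms by (simp add: abs_square_le_1)
  then have "\<bar>assoc_legendre l m x\<bar> \<le> 1 * \<bar>poly ((pderiv ^^ m) (legendre l)) x\<bar>"
    unfolding assoc_legendre_def abs_mult
    by (intro mult_right_mono) (auto simp: power_abs intro!: power_le_one)
  also have "\<dots> \<le> real (2 * l) ^ (2 * l)"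
    using abs_poly_le_coeff_norm[OF assms(2)] coeff_norm_legendre_pderiv[OF assms(1)]
    by (auto intro: order_trans)
  finally show ?thesis .
qed

lemma abs_sph_amp_le:
  assumes "\<bar>m\<bar> \<le> int l"
  shows "\<bar>sph_amp l m \<theta>\<bar> \<le> sph_norm l * real (2 * l) ^ (2 * l)"
proof -
  have f: "fact (l - nat \<bar>m\<bar>) / fact (l + nat \<bar>m\<bar>) \<le> (1::real)"
    by (simp add: fact_mono)
  have s: "sqrt ((2 * real l + 1) / (4 * pi) * (fact (l - nat \<bar>m\<bar>) / fact (l + nat \<bar>m\<bar>))) \<le> sph_norm l"
    unfolding sph_norm_def
    using mult_left_mono[OF f, of "(2 * real l + 1) / (4 * pi)"] by (intro real_sqrt_le_mono) simp
  have "\<bar>sph_amp l m \<theta>\<bar> = sqrt ((2 * real l + 1) / (4 * pi) * (fact (l - nat \<bar>m\<bar>) / fact (l + nat \<bar>m\<bar>)))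
      * \<bar>assoc_legendre l (nat \<bar>m\<bar>) (cos \<theta>)\<bar>"
    by (simp add: sph_amp_def abs_mult power_abs)
  also have "\<dots> \<le> sph_norm l * real (2 * l) ^ (2 * l)"
    using assms by (intro mult_mono s abs_assoc_legendre_le) (auto simp: sph_norm_def)
  finally show ?thesis .
qed

lemma norm_sph_harm_le:
  assumes "\<bar>m\<bar> \<le> int l"
  shows "cmod (sph_harm l m p) \<le> sph_norm l * real (2 * l) ^ (2 * l)"
  using abs_sph_amp_le[OF assms] by (cases p) (simp add: sph_harm_eq norm_mult)

lemma measurable_sph_amp [measurable]: "sph_amp l m \<in> borel_measurable borel"
  unfolding sph_amp_def assoc_legendre_def
  by (intro borel_measurable_continuous_onI continuous_intros)

lemma measurable_sph_harm [measurable]: "sph_harm l m \<in> borel_measurable borel"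
proof -
  have eq: "sph_harm l m = (\<lambda>p. of_real (sph_amp l m (fst p)) * cis (real_of_int m * snd p))"
    by (auto simp: sph_harm_eq)
  have "continuous_on UNIV (sph_harm l m)"
    unfolding eq sph_amp_def assoc_legendre_def
    by (intro continuous_intros)
  then show ?thesis by (rule borel_measurable_continuous_onI)
qed

lemma sets_sphere_measure [measurable_cong, simp]: "sets sphere_measure = sets borel"
  by (simp add: sphere_measure_def)

lemma space_sphere_measure [simp]: "space sphere_measure = UNIV"
  by (simp add: sphere_measure_def)

lemma sphere_measure_eq:
  "sphere_measure = density lborel (\<lambda>p. ennreal (indicator ({0..pi} \<times> {0..2 * pi}) p * sin (fst p)))"
  unfolding sphere_measure_def by (intro arg_cong[of _ _ "density lborel"]) auto

lemma sphere_weight_measurable [measurable]: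
  "(\<lambda>p. indicator ({0..pi} \<times> {0..2 * pi}) p * sin (fst p) :: real) \<in> borel_measurable borel"
proof -
  have "{0..pi} \<times> {0..2 * pi} \<in> sets (borel :: (real \<times> real) measure)"
    by (intro borel_closed closed_Times) auto
  moreover have "(\<lambda>p :: real \<times> real. sin (fst p)) \<in> borel_measurable borel"
    by (intro borel_measurable_continuous_onI continuous_intros)
  ultimately show ?thesis by (intro borel_measurable_times borel_measurable_indicator)
qed

lemma emeasure_sphere_measure_finite: "emeasure sphere_measure UNIV < \<infinity>"
proof -
  let ?I = "{0..pi} \<times> {0..2 * pi}"
  have I: "?I = cbox (0, 0) (pi, 2 * pi)" by (simp add: cbox_Pair_eq)
  have "emeasure sphere_measure UNIV = (\<integral>\<^sup>+ p. ennreal (indicator ?I p * sin (fst p)) \<partial>lborel)"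
    unfolding sphere_measure_eq using sphere_weight_measurable by (subst emeasure_density) auto
  also have "\<dots> \<le> (\<integral>\<^sup>+ p. indicator ?I p \<partial>lborel)"
    by (intro nn_integral_mono) (auto simp: indicator_def ennreal_le_1 split: prod.splits)
  also have "\<dots> = emeasure lborel ?I" unfolding I by simp
  also have "\<dots> < \<infinity>" unfolding I by (rule emeasure_lborel_cbox_finite)
  finally show ?thesis .
qed

interpretation sph: finite_measure sphere_measure
  using emeasure_sphere_measure_finite by (intro finite_measureI) simp

lemma integral_sphere_product:
  fixes f :: "real \<Rightarrow> real" and g :: "real \<Rightarrow> complex"
  assumes f: "f \<in> borel_measurable borel" "integrable lborel (\<lambda>x. f x * sin x * indicator {0..pi} x)"
    and g: "g \<in> borel_measurable borel" "integrable lborel (\<lambda>y. indicator {0..2 * pi} y *\<^sub>R g y)"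
  shows "(\<integral>p. of_real (f (fst p)) * g (snd p) \<partial>sphere_measure)
    = of_real (\<integral>x. f x * sin x * indicator {0..pi} x \<partial>lborel)
      * (\<integral>y. indicator {0..2 * pi} y *\<^sub>R g y \<partial>lborel)"
proof -
  let ?w = "\<lambda>p. indicator ({0..pi} \<times> {0..2 * pi}) p * sin (fst p) :: real"
  have [measurable]: "f \<in> borel_measurable borel" "g \<in> borel_measurable borel" by fact+
  define F where "F x = f x * sin x * indicator {0..pi} x" for x
  define G where "G y = indicator {0..2 * pi} y *\<^sub>R g y" for y :: real
  have [measurable]: "F \<in> borel_measurable borel" "G \<in> borel_measurable borel"
    unfolding F_def G_def by measurable
  have iF: "integrable lborel F" using f(2) unfolding F_def .
  have iG: "integrable lborel G" using g(2) unfolding G_def .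

  have hm: "(\<lambda>p. complex_of_real (f (fst p)) * g (snd p)) \<in> borel_measurable borel"
    unfolding borel_prod[symmetric] by measurable

  have "(\<integral>p. of_real (f (fst p)) * g (snd p) \<partial>sphere_measure)
      = (\<integral>p. ?w p *\<^sub>R (of_real (f (fst p)) * g (snd p)) \<partial>lborel)"
    unfolding sphere_measure_eq
    by (rule integral_density)
      (use sphere_weight_measurable hm in \<open>auto simp: indicator_def sin_ge_zero\<close>)
  also have "\<dots> = (\<integral>p. of_real (F (fst p)) * G (snd p) \<partial>(lborel \<Otimes>\<^sub>M lborel))"
    unfolding lborel_prod by (intro Bochner_Integration.integral_cong)
      (auto simp: indicator_def scaleR_conv_of_real F_def G_def)
  also have "\<dots> = (\<integral>x. (\<integral>y. of_real (F x) * G y \<partial>lborel) \<partial>lborel)"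
  proof -
    have "integrable (lborel \<Otimes>\<^sub>M lborel) (\<lambda>(x, y). complex_of_real (F x) * G y)"
    proof (rule lborel_pair.Fubini_integrable)
      show "(\<lambda>(x, y). complex_of_real (F x) * G y) \<in> borel_measurable (lborel \<Otimes>\<^sub>M lborel)"
        by measurable
      show "integrable lborel (\<lambda>x. \<integral>y. norm (case (x, y) of (x, y) \<Rightarrow> complex_of_real (F x) * G y) \<partial>lborel)"
        using iF by (simp add: norm_mult)
      show "AE x in lborel. integrable lborel (\<lambda>y. case (x, y) of (x, y) \<Rightarrow> complex_of_real (F x) * G y)"
        using iG by simp
    qed
    from lborel_pair.integral_fst[OF this] show ?thesis by (simp add: case_prod_beta')
  qed
  also have "\<dots> = of_real (integral\<^sup>L lborel F) * integral\<^sup>L lborel G"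
    using iF iG by simp
  finally show ?thesis unfolding F_def G_def .
qed

lemma integral_cis:
  "(\<integral>y. indicator {0..2 * pi} y *\<^sub>R cis (real_of_int k * y) \<partial>lborel) = (if k = 0 then 2 * pi else 0)"
proof (cases "k = 0")
  case True
  have "(\<integral>y. indicator {0..2 * pi} y *\<^sub>R (1::complex) \<partial>lborel) = measure lborel {0..2 * pi} *\<^sub>R 1"
    by (subst integral_scaleR_left) (auto simp: scaleR_conv_of_real)
  then show ?thesis using True by (simp add: scaleR_conv_of_real)
next
  case False
  let ?F = "\<lambda>y. cis (real_of_int k * y) / (\<i> * of_int k)"
  have "(\<integral>y. indicator {0..2 * pi} y *\<^sub>R cis (real_of_int k * y) \<partial>lborel) = ?F (2 * pi) - ?F 0"
  proof (rule integral_FTC_Icc)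
    show "(?F has_vector_derivative cis (real_of_int k * x)) (at x within {0..2 * pi})" for x
    proof -
      have "((\<lambda>z. exp (\<i> * of_int k * z) / (\<i> * of_int k)) has_field_derivative exp (\<i> * of_int k * of_real x))
          (at (of_real x))"
        using False by (auto intro!: derivative_eq_intros)
      from has_vector_derivative_real_field[OF this] show ?thesis
        by (simp add: cis_conv_exp mult.assoc)
    qed
    show "continuous_on {0..2 * pi} (\<lambda>x. cis (real_of_int k * x))"
      by (intro continuous_intros)
  qed simp
  moreover have "cis (real_of_int k * (2 * pi)) = 1"
    using cis_multiple_2pi[of "real_of_int k"] by (simp add: mult.commute mult.left_commute)
  ultimately show ?thesis using False by simp
qed

text \<open>For equal orders the two square roots combine into a true power of 1 - cos^2, so the
  integrand is a polynomial in cos times sin. Different orders are separated by the azimuthal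
  integral, which also supplies the missing factor 2 pi.\<close>

lemma sph_amp_integral:
  assumes "\<bar>m\<bar> \<le> int l" "\<bar>m\<bar> \<le> int l'"
  shows "(\<integral>x. sph_amp l m x * sph_amp l' m x * sin x * indicator {0..pi} x \<partial>lborel)
    = (if l = l' then 1 / (2 * pi) else 0)"
proof -
  define n where "n = nat \<bar>m\<bar>"
  have n: "n \<le> l" "n \<le> l'" using assms by (auto simp: n_def)
  define c where "c k = sqrt ((2 * real k + 1) / (4 * pi) * (fact (k - n) / fact (k + n)))" for k
  define q where "q = (- [:-1, 0, 1:]) ^ n * (pderiv ^^ n) (legendre l) * (pderiv ^^ n) (legendre l')"
  have "sph_amp l m x * sph_amp l' m x = c l * c l' * poly q (cos x)" for x
  proof -
    have "sqrt (1 - (cos x)\<^sup>2) ^ n * sqrt (1 - (cos x)\<^sup>2) ^ n = (1 - (cos x)\<^sup>2) ^ n"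
      by (simp add: abs_square_le_1 flip: power_mult_distrib)
    moreover have "poly ((- [:-1, 0, 1:]) ^ n) (cos x) = (1 - (cos x)\<^sup>2) ^ n"
      by (simp add: poly_power power2_eq_square)
    ultimately have q: "poly q (cos x) = sqrt (1 - (cos x)\<^sup>2) ^ n * sqrt (1 - (cos x)\<^sup>2) ^ n
       * poly ((pderiv ^^ n) (legendre l)) (cos x) * poly ((pderiv ^^ n) (legendre l')) (cos x)"
      by (simp only: q_def poly_mult)
    have e: "(-1::real) ^ n * (-1) ^ n = 1" by (simp flip: power_add mult_2)
    have "sph_amp l m x * sph_amp l' m x = ((-1) ^ n * (-1) ^ n) * c l * c l' * poly q (cos x) *
         (if 0 \<le> m then 1 else (-1) ^ n * (-1) ^ n)"
      unfolding q sph_amp_def assoc_legendre_def n_def[symmetric] c_def[symmetric]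
      by (cases "0 \<le> m") (simp_all only: if_True if_False ac_simps)
    then show ?thesis by (simp only: e) simp
  qed
  then have "(\<integral>x. sph_amp l m x * sph_amp l' m x * sin x * indicator {0..pi} x \<partial>lborel)
    = c l * c l' * cos_integral q"
    unfolding cos_integral_def by (subst integral_mult_right_zero[symmetric]) (simp add: mult.assoc)
  also have "\<dots> = (if l = l' then 1 / (2 * pi) else 0)"
  proof (cases "l = l'")
    case True
    have cc: "c l * c l = (2 * real l + 1) / (4 * pi) * (fact (l - n) / fact (l + n))"
      unfolding c_def by simp
    have j: "cos_integral q = 2 / (2 * real l + 1) * (fact (l + n) / fact (l - n))"
      unfolding q_def cos_integral_assoc_legendre[OF n] using True by simp
    have "2 * real l + 1 \<noteq> 0" by linarith
    then have "c l * c l * cos_integral q = 1 / (2 * pi)"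
      unfolding cc j by (simp add: divide_simps)
    then show ?thesis using True by simp
  next
    case False
    then show ?thesis unfolding q_def cos_integral_assoc_legendre[OF n] by simp
  qed
  finally show ?thesis .
qed

lemma sph_harm_orthonormal:
  assumes "\<bar>m\<bar> \<le> int l" "\<bar>m'\<bar> \<le> int l'"
  shows "(\<integral>p. sph_harm l m p * cnj (sph_harm l' m' p) \<partial>sphere_measure)
    = (if l = l' \<and> m = m' then 1 else 0)"
proof -
  have "sph_harm l m p * cnj (sph_harm l' m' p)
      = of_real (sph_amp l m (fst p) * sph_amp l' m' (fst p)) * cis (real_of_int (m - m') * snd p)" for p
    by (cases p) (simp add: sph_harm_eq cis_cnj cis_mult algebra_simps)
  then have "(\<integral>p. sph_harm l m p * cnj (sph_harm l' m' p) \<partial>sphere_measure)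
    = (\<integral>p. of_real (sph_amp l m (fst p) * sph_amp l' m' (fst p)) * cis (real_of_int (m - m') * snd p) \<partial>sphere_measure)"
    by simp
  also have "\<dots> = of_real (\<integral>x. sph_amp l m x * sph_amp l' m' x * sin x * indicator {0..pi} x \<partial>lborel)
      * (\<integral>y. indicator {0..2 * pi} y *\<^sub>R cis (real_of_int (m - m') * y) \<partial>lborel)"
  proof (rule integral_sphere_product)
    have "continuous_on {0..pi} (\<lambda>x. sph_amp l m x * sph_amp l' m' x * sin x)"
      unfolding sph_amp_def assoc_legendre_def by (intro continuous_intros)
    from borel_integrable_atLeastAtMost'[OF this]
    show "integrable lborel (\<lambda>x. sph_amp l m x * sph_amp l' m' x * sin x * indicator {0..pi} x)"
      unfolding set_integrable_def by (simp add: mult.commute)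
    have "continuous_on {0..2*pi} (\<lambda>y. cis (real_of_int (m - m') * y))" by (intro continuous_intros)
    from borel_integrable_atLeastAtMost'[OF this]
    show "integrable lborel (\<lambda>y. indicator {0..2 * pi} y *\<^sub>R cis (real_of_int (m - m') * y))"
      unfolding set_integrable_def .
    show "(\<lambda>y. cis (real_of_int (m - m') * y)) \<in> borel_measurable borel"
      by (intro borel_measurable_continuous_onI continuous_intros)
  qed measurable
  also have "\<dots> = (if l = l' \<and> m = m' then 1 else 0)"
  proof (cases "m = m'")
    case True
    with assms sph_amp_integral[of m l l'] integral_cis[of 0] show ?thesis by simp
  next
    case False
    then show ?thesis using integral_cis[of "m - m'"] by simp
  qed
  finally show ?thesis .
qed

subsection \<open>The regularized coefficients\<close>

text \<open>Completing the square: \<open>b\<close> enters only through a sum of terms in one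
  coefficient each. This is what decouples the minimization.\<close>

lemma (in finite_measure) orthonormal_residual:
  fixes e :: "'i \<Rightarrow> 'a \<Rightarrow> complex" and F :: "'a \<Rightarrow> complex" and b :: "'i \<Rightarrow> complex"
  assumes I: "finite I"
    and e: "\<And>i. i \<in> I \<Longrightarrow> e i \<in> borel_measurable M" "\<And>i x. i \<in> I \<Longrightarrow> cmod (e i x) \<le> B i"
    and on: "\<And>i j. i \<in> I \<Longrightarrow> j \<in> I \<Longrightarrow> (\<integral>x. e i x * cnj (e j x) \<partial>M) = (if i = j then 1 else 0)"
    and F: "F \<in> borel_measurable M" "integrable M (\<lambda>x. (cmod (F x))\<^sup>2)"
  defines "c \<equiv> \<lambda>i. \<integral>x. F x * cnj (e i x) \<partial>M"
  shows "integrable M (\<lambda>x. (cmod (F x - (\<Sum>i\<in>I. b i * e i x)))\<^sup>2)"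
    and "(\<integral>x. (cmod (F x - (\<Sum>i\<in>I. b i * e i x)))\<^sup>2 \<partial>M)
      = (\<integral>x. (cmod (F x))\<^sup>2 \<partial>M) - (\<Sum>i\<in>I. (cmod (c i))\<^sup>2) + (\<Sum>i\<in>I. (cmod (c i - b i))\<^sup>2)"
proof -
  have em [measurable]: "(\<lambda>x. cnj (e i x)) \<in> borel_measurable M" if "i \<in> I" for i
    using e(1)[OF that] by (intro borel_measurable_continuous_on[OF _ e(1)[OF that], of cnj]) (auto intro: continuous_intros)
  \<comment> \<open>On a finite measure space L^2 lies in L^1, by 2 |F| \<le> 1 + |F|^2; with the
    bounded \<open>e i\<close> this makes all inner products integrable.\<close>
  have "integrable M (\<lambda>x. 1 + (cmod (F x))\<^sup>2)" using F(2) by simp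
  then have F1: "integrable M F"
  proof (rule Bochner_Integration.integrable_bound[OF _ F(1)], intro AE_I2)
    fix x
    have "2 * cmod (F x) \<le> 1 + (cmod (F x))\<^sup>2"
      using sum_squares_bound[of 1 "cmod (F x)"] by simp
    then have "cmod (F x) \<le> 1 + (cmod (F x))\<^sup>2" using norm_ge_zero[of "F x"] by linarith
    then show "cmod (F x) \<le> norm (1 + (cmod (F x))\<^sup>2)" by simp
  qed
  have Fe: "integrable M (\<lambda>x. F x * cnj (e i x))" if i: "i \<in> I" for i
  proof (rule Bochner_Integration.integrable_bound)
    show "integrable M (\<lambda>x. of_real (B i) * F x)" using F1 by simp
    show "AE x in M. norm (F x * cnj (e i x)) \<le> norm (of_real (B i) * F x)"
    proof (intro AE_I2)
      fix x
      have "cmod (e i x) \<le> \<bar>B i\<bar>" using e(2)[OF i, of x] by linarith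
      then have "cmod (F x) * cmod (e i x) \<le> cmod (F x) * \<bar>B i\<bar>" by (rule mult_left_mono) simp
      then show "norm (F x * cnj (e i x)) \<le> norm (of_real (B i) * F x)"
        by (simp add: norm_mult mult.commute)
    qed
  qed (use F(1) em[OF i] in measurable)
  have ee: "integrable M (\<lambda>x. e i x * cnj (e j x))" if ij: "i \<in> I" "j \<in> I" for i j
  proof (rule integrable_const_bound)
    show "AE x in M. norm (e i x * cnj (e j x)) \<le> \<bar>B i\<bar> * \<bar>B j\<bar>"
    proof (intro AE_I2)
      fix x
      have "cmod (e i x) \<le> \<bar>B i\<bar>" "cmod (e j x) \<le> \<bar>B j\<bar>" using e(2)[OF ij(1), of x] e(2)[OF ij(2), of x] by linarith+
      then show "norm (e i x * cnj (e j x)) \<le> \<bar>B i\<bar> * \<bar>B j\<bar>"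
        by (simp add: norm_mult mult_mono)
    qed
  qed (use e(1)[OF ij(1)] em[OF ij(2)] in measurable)
  define G where "G x = (\<Sum>i\<in>I. b i * e i x)" for x
  have FG: "F x * cnj (G x) = (\<Sum>i\<in>I. cnj (b i) * (F x * cnj (e i x)))" for x
    by (simp add: G_def sum_distrib_left mult_ac)
  have GG: "G x * cnj (G x) = (\<Sum>i\<in>I. \<Sum>j\<in>I. (b i * cnj (b j)) * (e i x * cnj (e j x)))" for x
    by (simp add: G_def sum_product mult_ac)
  have iFG: "integrable M (\<lambda>x. F x * cnj (G x))"
    unfolding FG by (intro Bochner_Integration.integrable_sum integrable_mult_right Fe)
  have iGG: "integrable M (\<lambda>x. G x * cnj (G x))"
    unfolding GG by (intro Bochner_Integration.integrable_sum integrable_mult_right ee)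
  have vFG: "(\<integral>x. F x * cnj (G x) \<partial>M) = (\<Sum>i\<in>I. cnj (b i) * c i)"
    unfolding FG c_def by (subst Bochner_Integration.integral_sum) (auto intro!: integrable_mult_right Fe)
  have "(\<integral>x. G x * cnj (G x) \<partial>M) = (\<Sum>i\<in>I. \<Sum>j\<in>I. (b i * cnj (b j)) * (\<integral>x. e i x * cnj (e j x) \<partial>M))"
    unfolding GG
  proof (subst Bochner_Integration.integral_sum)
    show "integrable M (\<lambda>x. \<Sum>j\<in>I. (b i * cnj (b j)) * (e i x * cnj (e j x)))" if "i \<in> I" for i
      using that by (intro Bochner_Integration.integrable_sum integrable_mult_right ee)
    show "(\<Sum>i\<in>I. \<integral>x. (\<Sum>j\<in>I. (b i * cnj (b j)) * (e i x * cnj (e j x))) \<partial>M)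
        = (\<Sum>i\<in>I. \<Sum>j\<in>I. (b i * cnj (b j)) * (\<integral>x. e i x * cnj (e j x) \<partial>M))"
      by (intro sum.cong refl, subst Bochner_Integration.integral_sum)
        (auto intro!: integrable_mult_right ee)
  qed
  also have "\<dots> = (\<Sum>i\<in>I. b i * cnj (b i))"
    using I by (intro sum.cong refl) (simp add: on if_distrib cong: if_cong)
  finally have vGG: "(\<integral>x. G x * cnj (G x) \<partial>M) = (\<Sum>i\<in>I. b i * cnj (b i))" .
  have sq: "(cmod (u - v))\<^sup>2 = (cmod u)\<^sup>2 - 2 * Re (u * cnj v) + Re (v * cnj v)" for u v
    unfolding cmod_power2 by (simp add: power2_eq_square algebra_simps)
  have eq: "(cmod (F x - (\<Sum>i\<in>I. b i * e i x)))\<^sup>2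
      = (cmod (F x))\<^sup>2 - 2 * Re (F x * cnj (G x)) + Re (G x * cnj (G x))" for x
    unfolding G_def[symmetric] by (rule sq)
  show "integrable M (\<lambda>x. (cmod (F x - (\<Sum>i\<in>I. b i * e i x)))\<^sup>2)"
    unfolding eq using F(2) iFG iGG by (intro Bochner_Integration.integrable_add Bochner_Integration.integrable_diff integrable_mult_right integrable_Re)
  have "(\<integral>x. (cmod (F x - (\<Sum>i\<in>I. b i * e i x)))\<^sup>2 \<partial>M)
      = (\<integral>x. (cmod (F x))\<^sup>2 \<partial>M) - 2 * Re (\<Sum>i\<in>I. cnj (b i) * c i) + Re (\<Sum>i\<in>I. b i * cnj (b i))"
    unfolding eq vFG[symmetric] vGG[symmetric] using F(2) iFG iGG
    by (simp add: integral_Re integrable_Re del: times_complex.sel)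
  also have "\<dots> = (\<integral>x. (cmod (F x))\<^sup>2 \<partial>M) + (\<Sum>i\<in>I. Re (b i * cnj (b i)) - 2 * Re (cnj (b i) * c i))"
    by (simp add: sum_subtractf sum_distrib_left Re_sum del: times_complex.sel)
  also have "(\<Sum>i\<in>I. Re (b i * cnj (b i)) - 2 * Re (cnj (b i) * c i))
      = (\<Sum>i\<in>I. (cmod (c i - b i))\<^sup>2 - (cmod (c i))\<^sup>2)"
    by (intro sum.cong refl) (simp add: sq mult.commute)
  finally show "(\<integral>x. (cmod (F x - (\<Sum>i\<in>I. b i * e i x)))\<^sup>2 \<partial>M)
      = (\<integral>x. (cmod (F x))\<^sup>2 \<partial>M) - (\<Sum>i\<in>I. (cmod (c i))\<^sup>2) + (\<Sum>i\<in>I. (cmod (c i - b i))\<^sup>2)"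
    by (simp add: sum_subtractf)
qed

lemma measurable_sphere_measure_eq: "measurable sphere_measure N = measurable borel N"
  by (rule measurable_cong_sets) simp_all

lemma sphere_point_in_sphere: "sphere_point p \<in> sphere 0 1"
proof (cases p)
  case (Pair \<theta> \<phi>)
  have "(sin \<theta> * cos \<phi>)\<^sup>2 + (sin \<theta> * sin \<phi>)\<^sup>2 + (cos \<theta>)\<^sup>2
      = (sin \<theta>)\<^sup>2 * ((sin \<phi>)\<^sup>2 + (cos \<phi>)\<^sup>2) + (cos \<theta>)\<^sup>2"
    by (simp only: power_mult_distrib distrib_left add.commute)
  also have "\<dots> = 1" by simp
  finally show ?thesis
    by (simp add: Pair sphere_point_def norm_vec_def L2_set_def sum_3 vector_3 dist_norm)
qed

lemma measurable_sphere_point: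
  "sphere_point \<in> sphere_measure \<rightarrow>\<^sub>M restrict_space borel (sphere 0 1)"
proof -
  have eq: "sphere_point = (\<lambda>p. (sin (fst p) * cos (snd p)) *\<^sub>R axis 1 1
      + (sin (fst p) * sin (snd p)) *\<^sub>R axis 2 1 + cos (fst p) *\<^sub>R axis 3 1)"
    by (auto simp: sphere_point_def vec_eq_iff forall_3 vector_3 axis_def)
  have "continuous_on UNIV sphere_point" unfolding eq by (intro continuous_intros)
  then have "sphere_point \<in> borel_measurable borel" by (rule borel_measurable_continuous_onI)
  then show ?thesis
    using sphere_point_in_sphere
    unfolding measurable_sphere_measure_eq by (intro measurable_restrict_space2) auto
qed

definition sph_coeff :: "(real ^ 3 \<Rightarrow> real) \<Rightarrow> nat \<Rightarrow> int \<Rightarrow> complex" where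
  "sph_coeff f l m = (\<integral>p. of_real (f (sphere_point p)) * cnj (sph_harm l m p) \<partial>sphere_measure)"

text \<open>For square-integrable \<open>f\<close>, the squared distance from \<open>f\<close> to
  the span of the harmonics of degree at most L: the part of the residual that no array can
  change.\<close>

definition bessel_gap :: "(real ^ 3 \<Rightarrow> real) \<Rightarrow> nat \<Rightarrow> real" where
  "bessel_gap f L = (\<integral>p. (f (sphere_point p))\<^sup>2 \<partial>sphere_measure)
     - (\<Sum>l\<le>L. \<Sum>m = - int l..int l. (cmod (sph_coeff f l m))\<^sup>2)"

lemma residual_eq:
  assumes "square_integrable_on_sphere f"
  shows "0 \<le> bessel_gap f L"
    and "residual f b L = ennreal (bessel_gap f L
      + (\<Sum>l\<le>L. \<Sum>m = - int l..int l. (cmod (sph_coeff f l m - b l m))\<^sup>2))"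
proof -
  define F where "F p = complex_of_real (f (sphere_point p))" for p
  define I where "I = (SIGMA l:{..L}. {- int l..int l})"
  have I: "finite I" by (simp add: I_def)
  have mem: "\<bar>snd i\<bar> \<le> int (fst i)" if "i \<in> I" for i using that by (auto simp: I_def)
  have fm: "(\<lambda>p. f (sphere_point p)) \<in> borel_measurable sphere_measure"
    using assms measurable_sphere_point unfolding square_integrable_on_sphere_def
    by (auto intro: measurable_compose)
  then have Fm: "F \<in> borel_measurable sphere_measure"
    unfolding F_def by (rule measurable_compose[OF _ borel_measurable_of_real])
  have cF: "(cmod (F p))\<^sup>2 = (f (sphere_point p))\<^sup>2" for p by (simp add: F_def)
  have "integrable sphere_measure (\<lambda>p. (f (sphere_point p))\<^sup>2)"
    using assms fm unfolding square_integrable_on_sphere_def by (intro integrableI_bounded) auto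
  then have Fi: "integrable sphere_measure (\<lambda>p. (cmod (F p))\<^sup>2)" by (simp add: cF)
  let ?e = "\<lambda>i. sph_harm (fst i) (snd i)"
  have on: "(\<integral>x. ?e i x * cnj (?e j x) \<partial>sphere_measure) = (if i = j then 1 else 0)"
    if "i \<in> I" "j \<in> I" for i j
    using sph_harm_orthonormal[OF mem[OF that(1)] mem[OF that(2)]] by (simp add: prod_eq_iff)
  have em: "?e i \<in> borel_measurable sphere_measure" for i
    unfolding measurable_sphere_measure_eq by (rule measurable_sph_harm)
  note R = sph.orthonormal_residual[OF I em norm_sph_harm_le[OF mem] on Fm Fi]
  have S: "(\<Sum>i\<in>I. g (fst i) (snd i)) = (\<Sum>l\<le>L. \<Sum>m = - int l..int l. g l m)" for g :: "nat \<Rightarrow> int \<Rightarrow> 'z::comm_monoid_add"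
    unfolding I_def by (subst sum.Sigma) (auto simp: case_prod_beta)
  have *: "(\<Sum>i\<in>I. (\<lambda>i. b (fst i) (snd i)) i * ?e i p) = (\<Sum>l\<le>L. multipole b l p)" for p b
    using S[of "\<lambda>l m. b l m * sph_harm l m p"] by (simp add: multipole_def)
  have val: "(\<integral>p. (cmod (F p - (\<Sum>l\<le>L. multipole b l p)))\<^sup>2 \<partial>sphere_measure)
    = bessel_gap f L + (\<Sum>l\<le>L. \<Sum>m = - int l..int l. (cmod (sph_coeff f l m - b l m))\<^sup>2)"
    for b
    using R(2)[of "\<lambda>i. b (fst i) (snd i)"] unfolding *
      S[of "\<lambda>l m. (cmod (\<integral>x. F x * cnj (sph_harm l m x) \<partial>sphere_measure))\<^sup>2"]
      S[of "\<lambda>l m. (cmod ((\<integral>x. F x * cnj (sph_harm l m x) \<partial>sphere_measure) - b l m))\<^sup>2"]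
    by (simp only: cF) (simp only: F_def sph_coeff_def bessel_gap_def)
  show "0 \<le> bessel_gap f L"
  proof -
    have "0 \<le> (\<integral>p. (cmod (F p - (\<Sum>l\<le>L. multipole (sph_coeff f) l p)))\<^sup>2 \<partial>sphere_measure)" by simp
    then show ?thesis unfolding val by simp
  qed
  have "integrable sphere_measure (\<lambda>p. (cmod (F p - (\<Sum>l\<le>L. multipole b l p)))\<^sup>2)"
    using R(1)[of "\<lambda>i. b (fst i) (snd i)"] unfolding * .
  from nn_integral_eq_integral[OF this]
  show "residual f b L = ennreal (bessel_gap f L
      + (\<Sum>l\<le>L. \<Sum>m = - int l..int l. (cmod (sph_coeff f l m - b l m))\<^sup>2))"
    unfolding residual_def F_def[symmetric] val by simp
qed

text \<open>The gaps decrease to a limit \<open>t\<close>, which is one constant for all arrays and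
  so cannot influence the minimizer. Convergence in \<open>ennreal\<close> covers arrays that are
  not square-summable, where the limit is infinite.\<close>

lemma residual_tendsto:
  assumes "square_integrable_on_sphere f"
  shows "\<exists>t\<ge>0. \<forall>b. residual f b \<longlonglongrightarrow>
    ennreal t + (\<Sum>l. \<Sum>m = - int l..int l. ennreal ((cmod (sph_coeff f l m - b l m))\<^sup>2))"
proof -
  have "decseq (bessel_gap f)"
    unfolding decseq_Suc_iff bessel_gap_def by (simp add: sum_nonneg)
  then obtain t where t: "bessel_gap f \<longlonglongrightarrow> t"
    using decseq_convergent[of "bessel_gap f" 0] residual_eq(1)[OF assms] by blast
  show ?thesis
  proof (intro exI[of _ t] conjI allI)
    show "0 \<le> t" using residual_eq(1)[OF assms] by (intro LIMSEQ_le_const[OF t]) blast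
    fix b
    have eq: "residual f b = (\<lambda>L. ennreal (bessel_gap f L)
      + (\<Sum>l\<le>L. \<Sum>m = - int l..int l. ennreal ((cmod (sph_coeff f l m - b l m))\<^sup>2)))"
      using residual_eq[OF assms] by (simp add: fun_eq_iff ennreal_plus sum_nonneg sum_ennreal)
    show "residual f b \<longlonglongrightarrow>
      ennreal t + (\<Sum>l. \<Sum>m = - int l..int l. ennreal ((cmod (sph_coeff f l m - b l m))\<^sup>2))"
      unfolding eq by (intro tendsto_add tendsto_ennrealI[OF t] summable_LIMSEQ' summableI)
  qed
qed

text \<open>Once L \<ge> l, the residual dominates the squared error of this single coefficient. The
  lemma identifies the Gaussian coefficients of the expansion with the integrals that the minimizer
  sees.\<close>

lemma residual_zero_imp_coeff:
  assumes f: "square_integrable_on_sphere f" and 0: "residual f a \<longlonglongrightarrow> 0" and m: "\<bar>m\<bar> \<le> int l"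
  shows "sph_coeff f l m = a l m"
proof -
  have "ennreal ((cmod (sph_coeff f l m - a l m))\<^sup>2) \<le> 0"
  proof (rule LIMSEQ_le_const[OF 0], intro exI allI impI)
    fix L assume L: "l \<le> L"
    let ?g = "\<lambda>l m. (cmod (sph_coeff f l m - a l m))\<^sup>2"
    have "?g l m \<le> (\<Sum>m = - int l..int l. ?g l m)"
      using m by (intro member_le_sum) auto
    also have "\<dots> \<le> (\<Sum>l\<le>L. \<Sum>m = - int l..int l. ?g l m)"
      using L by (intro member_le_sum[where f = "\<lambda>l. \<Sum>m = - int l..int l. ?g l m"]) (auto intro: sum_nonneg)
    finally show "ennreal (?g l m) \<le> residual f a L"
      unfolding residual_eq(2)[OF f] using residual_eq(1)[OF f, of L] by (intro ennreal_leI) linarith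
  qed
  then show ?thesis by (simp add: ennreal_eq_0_iff[symmetric])
qed

text \<open>The proximal map of lam |.|: for nonnegative \<open>lam\<close> it keeps the phase and
  shortens the modulus by \<open>lam\<close>, down to 0 at the least.\<close>

definition soft :: "real \<Rightarrow> complex \<Rightarrow> complex" where
  "soft lam z = (if cmod z \<le> lam then 0 else of_real (1 - lam / cmod z) * z)"

lemma measurable_soft [measurable]: "soft lam \<in> borel_measurable borel"
  unfolding soft_def by measurable

lemma norm_soft:
  assumes "0 \<le> lam"
  shows "cmod (soft lam z) = max 0 (cmod z - lam)"
proof (cases "cmod z \<le> lam")
  case False
  with assms have "0 < cmod z" "lam / cmod z \<le> 1" by (auto simp: divide_simps)
  then have "cmod (soft lam z) = (1 - lam / cmod z) * cmod z"
    using False by (simp add: soft_def norm_mult del: of_real_diff of_real_divide)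
  with False \<open>0 < cmod z\<close> show ?thesis by (simp add: left_diff_distrib)
qed (simp add: soft_def)

lemma soft_cnj: "soft lam (cnj z) = cnj (soft lam z)"
  by (simp add: soft_def)

lemma soft_sign: "soft lam ((-1) ^ n * z) = (-1) ^ n * soft lam z"
  by (cases "even n") (simp_all add: soft_def)

text \<open>Strong convexity: the difference \<open>c - soft lam c\<close> is a subgradient of the penalty at
  \<open>soft lam c\<close>.\<close>

lemma soft_minimizes:
  assumes "0 < lam"
  shows "lam * cmod (soft lam c) + (cmod (c - soft lam c))\<^sup>2 / 2 + (cmod (b - soft lam c))\<^sup>2 / 2
    \<le> lam * cmod b + (cmod (c - b))\<^sup>2 / 2"
proof -
  define s where "s = soft lam c"
  define u where "u = c - s"
  have "cmod u \<le> lam \<and> Re (u * cnj s) = lam * cmod s"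
  proof (cases "cmod c \<le> lam")
    case True
    then show ?thesis by (simp add: u_def s_def soft_def)
  next
    case False
    with assms have c: "0 < cmod c" "lam < cmod c" by auto
    define r where "r = lam / cmod c"
    have r: "0 < r" "r < 1" using c assms by (auto simp: r_def)
    have s: "s = of_real (1 - r) * c" using False by (simp add: s_def soft_def r_def)
    have u: "u = of_real r * c" unfolding u_def s by (simp add: algebra_simps)
    have "u * cnj s = of_real (r * (1 - r) * (cmod c)\<^sup>2)"
      unfolding u s of_real_mult complex_norm_square by (simp add: algebra_simps)
    moreover have "cmod s = (1 - r) * cmod c"
      unfolding s using r by (simp add: norm_mult del: of_real_diff)
    moreover have "r * cmod c = lam" using c by (simp add: r_def)
    moreover have "cmod u = r * cmod c" unfolding u using r by (simp add: norm_mult)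
    ultimately show ?thesis by (simp add: power2_eq_square)
  qed
  then have u: "cmod u \<le> lam" "Re (u * cnj s) = lam * cmod s" by auto
  have "Re (u * cnj b) \<le> cmod (u * cnj b)" by (rule complex_Re_le_cmod)
  also have "\<dots> \<le> lam * cmod b" using u(1) by (simp add: norm_mult mult_right_mono)
  finally have "0 \<le> lam * cmod b - lam * cmod s + Re (u * cnj (s - b))"
    using u(2) by (simp add: algebra_simps)
  moreover have "(cmod (c - b))\<^sup>2 = (cmod u)\<^sup>2 + (cmod (b - s))\<^sup>2 + 2 * Re (u * cnj (s - b))"
    unfolding cmod_power2 by (simp add: u_def power2_eq_square algebra_simps)
  ultimately show ?thesis unfolding s_def[symmetric] u_def[symmetric] by linarith
qed

text \<open>The objective is a constant plus a sum of functions of one coefficient each, so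
  \<open>soft_minimizes\<close> can be summed over all of them. Because \<open>arg_min\<close> is a
  choice, existence of a minimizer and its uniqueness at |m| \<le> l both have to be proved.\<close>

lemma reg_coeffs_eq_soft:
  assumes f: "square_integrable_on_sphere f" and lam: "0 < lam" and m: "\<bar>m\<bar> \<le> int l"
  shows "reg_coeffs lam f l m = soft lam (sph_coeff f l m)"
proof -
  define c where "c = sph_coeff f"
  define s where "s l m = soft lam (c l m)" for l m
  obtain t where t: "0 \<le> t" "\<And>b. residual f b \<longlonglongrightarrow>
    ennreal t + (\<Sum>l. \<Sum>m = - int l..int l. ennreal ((cmod (c l m - b l m))\<^sup>2))"
    using residual_tendsto[OF f] unfolding c_def by blast
  have half: "ennreal (1 / 2) * ennreal x = ennreal (x / 2)" if "0 \<le> x" for x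
    using that by (subst ennreal_mult[symmetric]) auto
  have obj: "reg_objective lam f b = ennreal (t / 2)
      + (\<Sum>l. \<Sum>m = - int l..int l. ennreal (lam * cmod (b l m) + (cmod (c l m - b l m))\<^sup>2 / 2))" for b
  proof -
    have "reg_objective lam f b = ennreal lam * (\<Sum>l. \<Sum>m = - int l..int l. ennreal (cmod (b l m)))
     + ennreal (1 / 2) * (ennreal t + (\<Sum>l. \<Sum>m = - int l..int l. ennreal ((cmod (c l m - b l m))\<^sup>2)))"
      unfolding reg_objective_def using lim_imp_Liminf[OF _ t(2)] by simp
    also have "\<dots> = ennreal (t / 2) + ((\<Sum>l. \<Sum>m = - int l..int l. ennreal lam * ennreal (cmod (b l m)))
     + (\<Sum>l. \<Sum>m = - int l..int l. ennreal (1 / 2) * ennreal ((cmod (c l m - b l m))\<^sup>2)))"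
      using t(1) by (simp only: distrib_left half flip: ennreal_suminf_cmult sum_distrib_left) (simp only: ac_simps)
    also have "\<dots> = ennreal (t / 2)
      + (\<Sum>l. \<Sum>m = - int l..int l. ennreal (lam * cmod (b l m) + (cmod (c l m - b l m))\<^sup>2 / 2))"
      using lam by (subst suminf_add)
        (auto simp: half[simplified] ennreal_plus ennreal_mult sum.distrib summableI simp del: sum_ennreal)
    finally show ?thesis .
  qed
  \<comment> \<open>The excess over the minimum; it vanishes only if \<open>b\<close> agrees with
    \<open>s\<close> at all |m| \<le> l.\<close>
  define D where "D b = (\<Sum>l. \<Sum>m = - int l..int l. ennreal ((cmod (b l m - s l m))\<^sup>2 / 2))" for b
  have lower: "reg_objective lam f s + D b \<le> reg_objective lam f b" for b
  proof -
    have "reg_objective lam f s + D b = ennreal (t / 2)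
      + (\<Sum>l. \<Sum>m = - int l..int l. ennreal (lam * cmod (s l m) + (cmod (c l m - s l m))\<^sup>2 / 2
          + (cmod (b l m - s l m))\<^sup>2 / 2))"
      unfolding obj D_def add.assoc using lam
      by (subst suminf_add) (auto simp: ennreal_plus sum.distrib summableI add.assoc simp del: sum_ennreal)
    also have "\<dots> \<le> reg_objective lam f b"
      unfolding obj s_def using soft_minimizes[OF lam]
      by (intro add_left_mono suminf_le summableI sum_mono ennreal_leI) auto
    finally show ?thesis .
  qed
  \<comment> \<open>Finiteness permits the cancellation in \<open>ennreal\<close> below. The zero
    array is the competitor: its objective is half the squared norm of \<open>f\<close>.\<close>
  have fin: "reg_objective lam f s \<noteq> \<infinity>"
  proof -
    have "residual f (\<lambda>_ _. 0) = (\<lambda>L. \<integral>\<^sup>+ p. ennreal ((f (sphere_point p))\<^sup>2) \<partial>sphere_measure)"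
      by (simp add: residual_def multipole_def fun_eq_iff)
    then have "reg_objective lam f (\<lambda>_ _. 0)
        = ennreal (1 / 2) * (\<integral>\<^sup>+ p. ennreal ((f (sphere_point p))\<^sup>2) \<partial>sphere_measure)"
      by (simp add: reg_objective_def Liminf_const)
    also have "\<dots> < \<infinity>"
      using f ennreal_less_top[of "1 / 2"]
      by (simp only: infinity_ennreal_def ennreal_mult_less_top square_integrable_on_sphere_def simp_thms)
    finally have "reg_objective lam f (\<lambda>_ _. 0) < \<infinity>" .
    moreover have "reg_objective lam f s \<le> reg_objective lam f (\<lambda>_ _. 0)"
      using lower[of "\<lambda>_ _. 0"] by (rule order_trans[rotated]) simp
    ultimately show ?thesis by (auto simp: less_top[symmetric] top_unique)
  qed
  have s_min: "reg_objective lam f s \<le> reg_objective lam f b" for b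
    using lower[of b] by (rule order_trans[rotated]) simp
  \<comment> \<open>A witness is required before the value chosen by \<open>arg_min\<close> is known
    to be a minimizer.\<close>
  then have "is_arg_min (reg_objective lam f) (\<lambda>_. True) s"
    by (simp add: is_arg_min_linorder)
  then have "is_arg_min (reg_objective lam f) (\<lambda>_. True) (reg_coeffs lam f)"
    unfolding reg_coeffs_def arg_min_def
    by (rule someI[of "is_arg_min (reg_objective lam f) (\<lambda>_. True)"])
  then have "reg_objective lam f (reg_coeffs lam f) \<le> reg_objective lam f s"
    by (simp add: is_arg_min_linorder)
  with lower[of "reg_coeffs lam f"]
  have "reg_objective lam f s + D (reg_coeffs lam f) \<le> reg_objective lam f s + 0"
    unfolding add_0_right by (rule order_trans)
  then have "D (reg_coeffs lam f) = 0" using fin by (simp only: ennreal_add_left_cancel_le) simp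
  then have "(\<Sum>m = - int l..int l. ennreal ((cmod (reg_coeffs lam f l m - s l m))\<^sup>2 / 2)) = 0"
    unfolding D_def by (subst (asm) suminf_eq_zero_iff) auto
  then have "ennreal ((cmod (reg_coeffs lam f l m - s l m))\<^sup>2 / 2) = 0"
    using m by (subst (asm) sum_nonneg_eq_0_iff) (auto simp: abs_le_iff)
  then show ?thesis by (simp add: s_def c_def)
qed

lemma measurable_sph_coeff:
  assumes "(\<lambda>(\<omega>, x). T \<omega> x) \<in> borel_measurable (M \<Otimes>\<^sub>M restrict_space borel (sphere 0 1))"
  shows "(\<lambda>\<omega>. sph_coeff (T \<omega>) l m) \<in> borel_measurable M"
proof -
  have "(\<lambda>q. (fst q, sphere_point (snd q))) \<in> M \<Otimes>\<^sub>M sphere_measure \<rightarrow>\<^sub>M M \<Otimes>\<^sub>M restrict_space borel (sphere 0 1)"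
    by (intro measurable_Pair measurable_fst measurable_compose[OF measurable_snd measurable_sphere_point])
  from measurable_compose[OF this assms]
  have 1: "(\<lambda>q. T (fst q) (sphere_point (snd q))) \<in> borel_measurable (M \<Otimes>\<^sub>M sphere_measure)"
    by (simp add: case_prod_beta)
  have "(\<lambda>p. cnj (sph_harm l m p)) \<in> borel_measurable sphere_measure"
    unfolding measurable_sphere_measure_eq
    by (rule borel_measurable_continuous_on[OF _ measurable_sph_harm]) (intro continuous_intros)
  from measurable_compose[OF measurable_snd this]
  have 2: "(\<lambda>q. cnj (sph_harm l m (snd q))) \<in> borel_measurable (M \<Otimes>\<^sub>M sphere_measure)" .
  show ?thesis unfolding sph_coeff_def
    by (rule sph.borel_measurable_lebesgue_integral)
      (use borel_measurable_times[OF measurable_compose[OF 1 borel_measurable_of_real] 2] in \<open>simp add: case_prod_beta'\<close>)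
qed

subsection \<open>Gaussian moments under soft thresholding\<close>

text \<open>With u = |z|^2 / C, the fourth power is at most C^2 u^2. The quadratic Taylor term of
  exp at u / 20 is u^2 / 800, whence the factor 800. Above the threshold u \<ge> lam^2 / C, and 1/20
  = 3/4 - 7/10 trades u for the threshold.\<close>

lemma norm_soft_power4_le:
  assumes "0 < C" "0 < lam"
  shows "cmod (soft lam z) ^ 4
    \<le> 800 * C\<^sup>2 * exp (- (7 / 10) * (lam\<^sup>2 / C)) * exp (3 / 4 * ((cmod z)\<^sup>2 / C))"
proof (cases "cmod z \<le> lam")
  case True
  then show ?thesis by (simp add: soft_def)
next
  case False
  define u where "u = (cmod z)\<^sup>2 / C"
  have u: "lam\<^sup>2 / C \<le> u" "0 \<le> u"
    using False assms by (auto simp: u_def intro!: divide_right_mono power_mono)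
  have "cmod (soft lam z) ^ 4 \<le> cmod z ^ 4"
    using False assms by (intro power_mono) (auto simp: norm_soft)
  also have "\<dots> = C\<^sup>2 * u\<^sup>2"
    using assms by (simp add: u_def power_divide flip: power_mult)
  also have "u\<^sup>2 \<le> 800 * exp (u / 20)"
    using exp_lower_Taylor_quadratic[of "u / 20"] u by (simp add: power2_eq_square)
  also have "exp (u / 20) \<le> exp (- (7 / 10) * (lam\<^sup>2 / C) + 3 / 4 * u)"
    using u by simp
  finally show ?thesis
    using assms unfolding exp_add u_def by (simp only: mult_ac) simp
qed

text \<open>Tilting turns exp(-x^2 / C) into exp(-x^2 / (4 C)), which is the shape of variance 2 C.
  The standard deviation doubles, hence the value 2.\<close>

lemma (in prob_space) integral_exp_square_normal:
  assumes "0 < C" and X: "distributed M lborel X (normal_density 0 (sqrt (C / 2)))"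
  shows "integrable M (\<lambda>\<omega>. exp (3 / 4 * ((X \<omega>)\<^sup>2 / C)))"
    and "(\<integral>\<omega>. exp (3 / 4 * ((X \<omega>)\<^sup>2 / C)) \<partial>M) = 2"
proof -
  have eq: "normal_density 0 (sqrt (C / 2)) x * exp (3 / 4 * (x\<^sup>2 / C))
      = 2 * normal_density 0 (sqrt (2 * C)) x" for x
  proof -
    have "sqrt (2 * pi * (2 * C)) = sqrt (2\<^sup>2 * (pi * C))" by (simp add: mult_ac)
    also have "\<dots> = 2 * sqrt (pi * C)" by (simp only: real_sqrt_mult real_sqrt_power) simp
    finally have s: "sqrt (2 * pi * (2 * C)) = 2 * sqrt (pi * C)" .
    have "exp (- (x\<^sup>2 / C)) * exp (3 / 4 * (x\<^sup>2 / C)) = exp (- (x\<^sup>2 / (4 * C)))"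
      using assms(1) by (simp add: exp_add[symmetric] field_simps)
    then show ?thesis using assms(1) s by (simp add: normal_density_def)
  qed
  have "has_bochner_integral lborel (\<lambda>x. normal_density 0 (sqrt (C / 2)) x * exp (3 / 4 * (x\<^sup>2 / C))) 2"
    unfolding eq has_bochner_integral_iff using assms(1) by simp
  then show "integrable M (\<lambda>\<omega>. exp (3 / 4 * ((X \<omega>)\<^sup>2 / C)))" "(\<integral>\<omega>. exp (3 / 4 * ((X \<omega>)\<^sup>2 / C)) \<partial>M) = 2"
    using distributed_integrable[OF X, of "\<lambda>x. exp (3 / 4 * (x\<^sup>2 / C))"]
      distributed_integral[OF X, of "\<lambda>x. exp (3 / 4 * (x\<^sup>2 / C))"]
    by (auto simp: has_bochner_integral_iff normal_density_nonneg)
qed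

text \<open>A Chernoff bound: exp of |z|^2 factors into real and imaginary parts, and independence
  gives the exponential moment 2 * 2. Thus 3200 = 800 * 4.\<close>

lemma (in prob_space) soft_complex_gaussian:
  assumes C: "0 < C" and lam: "0 < lam" and Z: "Z \<in> borel_measurable M"
    and R: "distributed M lborel (\<lambda>\<omega>. Re (Z \<omega>)) (normal_density 0 (sqrt (C / 2)))"
    and I: "distributed M lborel (\<lambda>\<omega>. Im (Z \<omega>)) (normal_density 0 (sqrt (C / 2)))"
    and ind: "indep_var borel (\<lambda>\<omega>. Re (Z \<omega>)) borel (\<lambda>\<omega>. Im (Z \<omega>))"
  shows "integrable M (\<lambda>\<omega>. cmod (soft lam (Z \<omega>)) ^ 4)"
    and "(\<integral>\<omega>. cmod (soft lam (Z \<omega>)) ^ 4 \<partial>M) \<le> 3200 * C\<^sup>2 * exp (- (7 / 10) * (lam\<^sup>2 / C))"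
proof -
  let ?g = "\<lambda>x. exp (3 / 4 * (x\<^sup>2 / C))"
  have split: "exp (3 / 4 * ((cmod z)\<^sup>2 / C)) = ?g (Re z) * ?g (Im z)" for z
    by (simp add: cmod_power2 exp_add[symmetric] add_divide_distrib distrib_left)
  have ind': "indep_var borel (\<lambda>\<omega>. ?g (Re (Z \<omega>))) borel (\<lambda>\<omega>. ?g (Im (Z \<omega>)))"
    using indep_var_compose[OF ind, of ?g borel ?g borel] by (simp add: comp_def)
  note iR = integral_exp_square_normal[OF C R] and iI = integral_exp_square_normal[OF C I]
  have int: "integrable M (\<lambda>\<omega>. exp (3 / 4 * ((cmod (Z \<omega>))\<^sup>2 / C)))"
    unfolding split by (rule indep_var_integrable[OF ind' iR(1) iI(1)])
  have val: "(\<integral>\<omega>. exp (3 / 4 * ((cmod (Z \<omega>))\<^sup>2 / C)) \<partial>M) = 4"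
    unfolding split indep_var_lebesgue_integral[OF ind' iR(1) iI(1)] iR(2) iI(2) by simp
  define k where "k = 800 * C\<^sup>2 * exp (- (7 / 10) * (lam\<^sup>2 / C))"
  have le: "cmod (soft lam z) ^ 4 \<le> k * exp (3 / 4 * ((cmod z)\<^sup>2 / C))" for z
    using norm_soft_power4_le[OF C lam, of z] by (simp add: k_def)
  have ik: "integrable M (\<lambda>\<omega>. k * exp (3 / 4 * ((cmod (Z \<omega>))\<^sup>2 / C)))" using int by simp
  show i: "integrable M (\<lambda>\<omega>. cmod (soft lam (Z \<omega>)) ^ 4)"
  proof (rule Bochner_Integration.integrable_bound[OF ik])
    show "(\<lambda>\<omega>. cmod (soft lam (Z \<omega>)) ^ 4) \<in> borel_measurable M" using Z by measurable
  qed (use le in \<open>auto intro!: AE_I2 order_trans[OF le]\<close>)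
  have "(\<integral>\<omega>. cmod (soft lam (Z \<omega>)) ^ 4 \<partial>M) \<le> (\<integral>\<omega>. k * exp (3 / 4 * ((cmod (Z \<omega>))\<^sup>2 / C)) \<partial>M)"
    by (intro integral_mono i ik le)
  also have "\<dots> = k * 4" using val by simp
  finally show "(\<integral>\<omega>. cmod (soft lam (Z \<omega>)) ^ 4 \<partial>M) \<le> 3200 * C\<^sup>2 * exp (- (7 / 10) * (lam\<^sup>2 / C))"
    by (simp add: k_def mult_ac)
qed

text \<open>For the lower bound only the window from lam + \<sigma> to lam + 2 \<sigma> is kept.
  There the thresholded modulus is at least \<sigma> and the density at least its value at the right
  end; the window length \<sigma> cancels the \<sigma> in the density.\<close>

lemma (in prob_space) soft_real_gaussian:
  assumes C: "0 < C" and lam: "0 < lam"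
    and X: "distributed M lborel X (normal_density 0 (sqrt C))"
  shows "integrable M (\<lambda>\<omega>. cmod (soft lam (of_real (X \<omega>))) ^ k)"
    and "sqrt C ^ k * exp (- (lam / sqrt C + 2)\<^sup>2 / 2) / sqrt (2 * pi)
      \<le> (\<integral>\<omega>. cmod (soft lam (of_real (X \<omega>))) ^ k \<partial>M)"
proof -
  define \<sigma> where "\<sigma> = sqrt C"
  have \<sigma>: "0 < \<sigma>" using C by (simp add: \<sigma>_def)
  define g :: "real \<Rightarrow> real" where "g x = max 0 (\<bar>x\<bar> - lam) ^ k" for x
  have geq: "cmod (soft lam (of_real x)) ^ k = g x" for x
    using lam by (simp add: g_def norm_soft)
  have gm: "g \<in> borel_measurable lborel" unfolding g_def by measurable
  note X' = X[folded \<sigma>_def]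
  have int: "integrable lborel (\<lambda>x. normal_density 0 \<sigma> x * g x)"
  proof (rule Bochner_Integration.integrable_bound[OF integrable_normal_moment_abs[OF \<sigma>, of 0 k]])
    show "(\<lambda>x. normal_density 0 \<sigma> x * g x) \<in> borel_measurable lborel" using gm by measurable
    show "AE x in lborel. norm (normal_density 0 \<sigma> x * g x) \<le> norm (normal_density 0 \<sigma> x * \<bar>x - 0\<bar> ^ k)"
      using lam unfolding g_def
      by (intro AE_I2) (auto simp: abs_mult power_abs intro!: mult_left_mono power_mono)
  qed
  show "integrable M (\<lambda>\<omega>. cmod (soft lam (of_real (X \<omega>))) ^ k)"
    unfolding geq using distributed_integrable[OF X' gm] int by (simp add: normal_density_nonneg)
  define c where "c = 1 / sqrt (2 * pi * \<sigma>\<^sup>2) * exp (- (lam + 2 * \<sigma>)\<^sup>2 / (2 * \<sigma>\<^sup>2)) * \<sigma> ^ k"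
  let ?J = "{lam + \<sigma>..lam + 2 * \<sigma>}"
  have "c * \<sigma> = (\<integral>x. c * indicator ?J x \<partial>lborel)"
    using \<sigma> by simp
  also have "\<dots> \<le> (\<integral>x. normal_density 0 \<sigma> x * g x \<partial>lborel)"
  proof (rule integral_mono[OF _ int])
    show "integrable lborel (\<lambda>x. c * indicator ?J x)"
      by (intro integrable_mult_right integrable_real_indicator) (auto simp: emeasure_lborel_Icc_eq)
    fix x
    show "c * indicator ?J x \<le> normal_density 0 \<sigma> x * g x"
    proof (cases "x \<in> ?J")
      case True
      have "c \<le> normal_density 0 \<sigma> x * g x"
        unfolding c_def normal_density_def g_def using True lam \<sigma>
        by (intro mult_mono) (auto intro!: divide_right_mono power_mono divide_nonneg_pos)
      with True show ?thesis by simp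
    next
      case False
      then show ?thesis by (simp add: g_def normal_density_nonneg)
    qed
  qed
  also have "\<dots> = (\<integral>\<omega>. g (X \<omega>) \<partial>M)"
    by (rule distributed_integral[OF X' gm]) (simp add: normal_density_nonneg)
  finally have "c * \<sigma> \<le> (\<integral>\<omega>. cmod (soft lam (of_real (X \<omega>))) ^ k \<partial>M)"
    unfolding geq .
  moreover have "c * \<sigma> = sqrt C ^ k * exp (- (lam / sqrt C + 2)\<^sup>2 / 2) / sqrt (2 * pi)"
  proof -
    have "(lam + 2 * \<sigma>)\<^sup>2 / (2 * \<sigma>\<^sup>2) = (lam / \<sigma> + 2)\<^sup>2 / 2"
      using \<sigma> by (simp add: field_simps power2_eq_square)
    then have e: "- (lam + 2 * \<sigma>)\<^sup>2 / (2 * \<sigma>\<^sup>2) = - (lam / \<sigma> + 2)\<^sup>2 / 2" by simp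
    show ?thesis
      using \<sigma> unfolding c_def e by (simp add: real_sqrt_mult flip: \<sigma>_def)
  qed
  ultimately show "sqrt C ^ k * exp (- (lam / sqrt C + 2)\<^sup>2 / 2) / sqrt (2 * pi)
      \<le> (\<integral>\<omega>. cmod (soft lam (of_real (X \<omega>))) ^ k \<partial>M)" by simp
qed

subsection \<open>Degrees at which the Legendre polynomial is very small\<close>

text \<open>Factor over the complex numbers. A real point is at least as far from a complex root as
  from its real part, so the real parts of the roots serve as \<open>r\<close>.\<close>

lemma real_poly_lower_bound:
  fixes p :: "real poly"
  shows "\<exists>r. \<forall>x \<delta>. 0 \<le> \<delta> \<longrightarrow> (\<forall>i<degree p. \<delta> \<le> \<bar>x - r i\<bar>) \<longrightarrow> \<bar>lead_coeff p\<bar> * \<delta> ^ degree p \<le> \<bar>poly p x\<bar>"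
proof -
  define q where "q = map_poly complex_of_real p"
  have d: "degree q = degree p" unfolding q_def by (rule degree_map_poly) simp
  have l: "lead_coeff q = of_real (lead_coeff p)" by (simp add: q_def coeff_map_poly degree_map_poly)
  have pq: "poly q (of_real x) = of_real (poly p x)" for x
    unfolding q_def by (induction p) (auto simp: map_poly_pCons)
  obtain root where root: "smult (lead_coeff q) (\<Prod>i<degree q. [:-root i, 1:]) = q"
    by (rule complex_poly_decompose')
  show ?thesis
  proof (intro exI allI impI)
    fix x \<delta> :: real assume \<delta>: "0 \<le> \<delta>" and sep: "\<forall>i<degree p. \<delta> \<le> \<bar>x - Re (root i)\<bar>"
    have "\<delta> ^ degree p = (\<Prod>i<degree p. \<delta>)" by simp
    also have "\<dots> \<le> (\<Prod>i<degree p. cmod (of_real x - root i))"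
    proof (intro prod_mono conjI \<delta>)
      fix i assume "i \<in> {..<degree p}"
      then have "\<delta> \<le> \<bar>Re (of_real x - root i)\<bar>" using sep by simp
      also have "\<dots> \<le> cmod (of_real x - root i)" by (rule abs_Re_le_cmod)
      finally show "\<delta> \<le> cmod (of_real x - root i)" .
    qed
    finally have "\<bar>lead_coeff p\<bar> * \<delta> ^ degree p \<le> \<bar>lead_coeff p\<bar> * (\<Prod>i<degree p. cmod (of_real x - root i))"
      by (rule mult_left_mono) simp
    also have "\<dots> = cmod (poly (smult (lead_coeff q) (\<Prod>i<degree q. [:-root i, 1:])) (of_real x))"
    proof -
      have "cmod (coeff q (degree p)) = \<bar>lead_coeff p\<bar>" using l d by simp
      then show ?thesis unfolding d by (simp add: poly_prod norm_mult prod_norm)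
    qed
    also have "\<dots> = \<bar>poly p x\<bar>" unfolding root pq by simp
    finally show "\<bar>lead_coeff p\<bar> * \<delta> ^ degree p \<le> \<bar>poly p x\<bar>" .
  qed
qed

definition small_set :: "nat \<Rightarrow> real set" where
  "small_set l = {x. \<bar>poly (legendre l) x\<bar> < exp (- ((real l)\<^sup>2))}"

lemma small_set_measure:
  shows "small_set l \<in> sets borel" "emeasure lborel (small_set l) \<le> ennreal (2 * real l * exp (- real l))"
proof -
  have "open (small_set l)" unfolding small_set_def
    by (intro open_Collect_less continuous_intros)
  then show "small_set l \<in> sets borel" by (rule borel_open)
  \<comment> \<open>With this choice \<delta>^l is exactly the threshold exp(-l^2) of
    \<open>small_set\<close>, while the total length 2 l \<delta> of the intervals is summable in
    l.\<close>
  let ?\<delta> = "exp (- real l)"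
  obtain r where r: "\<And>x \<delta>. 0 \<le> \<delta> \<Longrightarrow> (\<And>i. i < l \<Longrightarrow> \<delta> \<le> \<bar>x - r i\<bar>) \<Longrightarrow>
      \<bar>coeff (legendre l) l\<bar> * \<delta> ^ l \<le> \<bar>poly (legendre l) x\<bar>"
    using real_poly_lower_bound[of "legendre l"] unfolding degree_legendre by metis
  have "small_set l \<subseteq> (\<Union>i\<in>{..<l}. {r i - ?\<delta>..r i + ?\<delta>})"
  proof
    fix x assume x: "x \<in> small_set l"
    show "x \<in> (\<Union>i\<in>{..<l}. {r i - ?\<delta>..r i + ?\<delta>})"
    proof (rule ccontr)
      assume "\<not> ?thesis"
      then have sep: "?\<delta> \<le> \<bar>x - r i\<bar>" if "i < l" for i
        using that by (force simp: abs_if)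
      have "exp (- ((real l)\<^sup>2)) = 1 * ?\<delta> ^ l"
        by (simp add: power2_eq_square flip: exp_of_nat_mult)
      also have "\<dots> \<le> \<bar>coeff (legendre l) l\<bar> * ?\<delta> ^ l"
        using coeff_legendre_ge_1[of l] by (intro mult_right_mono) auto
      also have "\<dots> \<le> \<bar>poly (legendre l) x\<bar>"
        by (rule r) (auto intro: sep)
      finally show False using x by (simp add: small_set_def)
    qed
  qed
  then have "emeasure lborel (small_set l) \<le> emeasure lborel (\<Union>i\<in>{..<l}. {r i - ?\<delta>..r i + ?\<delta>})"
    by (intro emeasure_mono) auto
  also have "\<dots> \<le> (\<Sum>i<l. emeasure lborel {r i - ?\<delta>..r i + ?\<delta>})"
    by (intro emeasure_subadditive_finite) auto
  also have "\<dots> = (\<Sum>i<l. ennreal (2 * ?\<delta>))" by (intro sum.cong refl) (simp add: emeasure_lborel_Icc_eq)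
  also have "\<dots> = ennreal (2 * real l * ?\<delta>)" by (simp add: ennreal_of_nat_eq_real_of_nat mult_ac flip: ennreal_mult)
  finally show "emeasure lborel (small_set l) \<le> ennreal (2 * real l * ?\<delta>)" .
qed

lemma summable_nat_mult_exp: "summable (\<lambda>l. 2 * real l * exp (- real l))"
proof (rule summable_comparison_test')
  show "summable (\<lambda>l. 4 * exp (- (1 / 2) :: real) ^ l)"
    by (intro summable_mult summable_geometric) simp
  fix l
  \<comment> \<open>Half of the exponential absorbs the linear factor; the other half is a geometric
    sequence.\<close>
  have "real l / 2 * exp (- (real l / 2)) \<le> exp (real l / 2) * exp (- (real l / 2))"
    using exp_ge_add_one_self[of "real l / 2"] by (intro mult_right_mono, linarith) simp
  then have "real l / 2 * exp (- (real l / 2)) \<le> 1" by (simp flip: exp_add)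
  then have "4 * (real l / 2 * exp (- (real l / 2))) * exp (- (real l / 2)) \<le> 4 * 1 * exp (- (real l / 2))"
    by (intro mult_right_mono) auto
  moreover have "exp (- real l) = exp (- (real l / 2)) * exp (- (real l / 2))"
    by (simp flip: exp_add)
  moreover have "exp (- (1 / 2) :: real) ^ l = exp (- (real l / 2))"
    by (simp flip: exp_of_nat_mult)
  ultimately show "norm (2 * real l * exp (- real l)) \<le> 4 * exp (- (1 / 2) :: real) ^ l"
    by (simp add: mult_ac)
qed

lemma AE_not_small_set: "AE x in lborel. \<forall>\<^sub>F l in sequentially. x \<notin> small_set l"
proof -
  have "AE x in lborel. \<forall>\<^sub>F l in sequentially. x \<in> space lborel - small_set l"
  proof (rule borel_cantelli_AE1)
    show "small_set l \<in> sets lborel" for l using small_set_measure(1) by simp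
    show fin: "emeasure lborel (small_set l) < \<infinity>" for l
      using small_set_measure(2)[of l] by (rule order.strict_trans1) simp
    show "summable (\<lambda>l. measure lborel (small_set l))"
    proof (rule summable_comparison_test'[OF summable_nat_mult_exp, of 0])
      fix l
      show "norm (measure lborel (small_set l)) \<le> 2 * real l * exp (- real l)"
        using small_set_measure(2)[of l] by (simp add: measure_def enn2real_leI)
    qed
  qed
  then show ?thesis by simp
qed

text \<open>An exceptional set in x corresponds to its image under arccos in the angle, and
  differentiable maps preserve null sets. Since arccos is not differentiable at 1 and -1, the angles
  0 and pi are discarded by hand.\<close>

lemma AE_cos:
  assumes "AE x in lborel. P x"
  shows "AE \<theta> in lborel. \<theta> \<in> {0..pi} \<longrightarrow> P (cos \<theta>)"
proof -
  define N where "N = {x. \<not> P x} \<inter> {-1<..<1}"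
  have "AE x in lebesgue. P x" using assms by (simp add: AE_completion_iff)
  then obtain N' where N': "{x. \<not> P x} \<subseteq> N'" "negligible N'"
    unfolding eventually_ae_filter negligible_iff_null_sets by auto
  then have "negligible N" unfolding N_def by (intro negligible_subset[OF N'(2)]) auto
  moreover have "arccos differentiable_on N"
  proof (unfold differentiable_on_def, intro ballI)
    fix x assume "x \<in> N"
    then have "DERIV arccos x :> inverse (- sqrt (1 - x\<^sup>2))" by (intro DERIV_arccos) (auto simp: N_def)
    then show "arccos differentiable (at x within N)"
      unfolding real_differentiable_def by (blast intro: has_field_derivative_at_within)
  qed
  ultimately have "negligible (arccos ` N)"
    by (intro negligible_differentiable_image_negligible) auto
  then have "negligible (arccos ` N \<union> {0, pi})" by simp
  then have "arccos ` N \<union> {0, pi} \<in> null_sets lebesgue" by (simp add: negligible_iff_null_sets)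
  then have "AE \<theta> in lebesgue. \<theta> \<notin> arccos ` N \<union> {0, pi}" by (rule AE_not_in)
  then have "AE \<theta> in lborel. \<theta> \<notin> arccos ` N \<union> {0, pi}" by (simp add: AE_completion_iff)
  then show ?thesis
  proof eventually_elim
    case (elim \<theta>)
    show ?case
    proof (intro impI, rule ccontr)
      assume \<theta>: "\<theta> \<in> {0..pi}" and nP: "\<not> P (cos \<theta>)"
      then have "0 < \<theta>" "\<theta> < pi" using elim by auto
      then have "-1 < cos \<theta>" "cos \<theta> < 1"
        using cos_monotone_0_pi[of \<theta> pi] cos_monotone_0_pi[of 0 \<theta>] by auto
      then have "cos \<theta> \<in> N" using nP by (simp add: N_def)
      then have "arccos (cos \<theta>) \<in> arccos ` N" by simp
      then show False using elim \<theta> by (simp add: arccos_cos)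
    qed
  qed
qed

lemma AE_regular_degrees:
  "AE \<theta> in lborel. \<theta> \<in> {0..pi} \<longrightarrow> (\<forall>\<^sub>F l in sequentially. l \<in> regular_degrees 1 \<theta>)"
  using AE_cos[OF AE_not_small_set]
  by eventually_elim (auto simp: small_set_def regular_degrees_def not_less)

subsection \<open>The ratio of kurtoses\<close>

text \<open>The mixed terms are absorbed pointwise: if |w| is small relative to |u| they cost at
  most \<epsilon> u^4, and otherwise |u| is bounded by a multiple of |w|. After integration only two
  pure fourth moments remain.\<close>

lemma power4_perturbation:
  fixes \<epsilon> :: real
  assumes "0 < \<epsilon>"
  shows "\<exists>K\<ge>0. \<forall>u w :: real. \<bar>(u + w) ^ 4 - u ^ 4\<bar> \<le> \<epsilon> * u ^ 4 + K * w ^ 4"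
proof -
  \<comment> \<open>The 15 is 4 + 6 + 4 + 1, from expanding (1 + \<delta>)^4 - 1 with every power of
    \<delta> at most \<delta>.\<close>
  define \<delta> where "\<delta> = min 1 (\<epsilon> / 15)"
  have \<delta>: "0 < \<delta>" "\<delta> \<le> 1" "15 * \<delta> \<le> \<epsilon>" using assms by (auto simp: \<delta>_def)
  have "\<bar>(u + w) ^ 4 - u ^ 4\<bar> \<le> \<epsilon> * u ^ 4 + (1 + 1 / \<delta>) ^ 4 * w ^ 4" for u w :: real
  proof -
    have a4: "\<bar>x\<bar> ^ 4 = x ^ 4" for x :: real by (simp add: power_even_abs)
    have "(u + w) ^ 4 - u ^ 4 = 4 * u ^ 3 * w + 6 * u\<^sup>2 * w\<^sup>2 + 4 * u * w ^ 3 + w ^ 4"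
      by (simp add: power4_eq_xxxx power2_eq_square power3_eq_cube algebra_simps)
    then have "\<bar>(u + w) ^ 4 - u ^ 4\<bar> \<le> \<bar>4 * u ^ 3 * w\<bar> + \<bar>6 * u\<^sup>2 * w\<^sup>2\<bar> + \<bar>4 * u * w ^ 3\<bar> + \<bar>w ^ 4\<bar>"
      by linarith
    also have "\<dots> = (\<bar>u\<bar> + \<bar>w\<bar>) ^ 4 - \<bar>u\<bar> ^ 4"
      unfolding abs_mult power_abs abs_numeral by algebra
    finally have le: "\<bar>(u + w) ^ 4 - u ^ 4\<bar> \<le> (\<bar>u\<bar> + \<bar>w\<bar>) ^ 4 - \<bar>u\<bar> ^ 4" .
    show ?thesis
    proof (cases "\<bar>w\<bar> \<le> \<delta> * \<bar>u\<bar>")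
      case True
      have "(\<bar>u\<bar> + \<bar>w\<bar>) ^ 4 \<le> ((1 + \<delta>) * \<bar>u\<bar>) ^ 4"
        using True by (intro power_mono) (auto simp: algebra_simps)
      also have "\<dots> = (1 + \<delta>) ^ 4 * \<bar>u\<bar> ^ 4" by (rule power_mult_distrib)
      also have "(1 + \<delta>) ^ 4 \<le> 1 + 15 * \<delta>"
      proof -
        have "\<delta> ^ 2 \<le> \<delta>" "\<delta> ^ 3 \<le> \<delta>" "\<delta> ^ 4 \<le> \<delta>"
          using \<delta> power_decreasing[of 1 _ \<delta>] by auto
        moreover have "(1 + \<delta>) ^ 4 = 1 + 4 * \<delta> + 6 * \<delta> ^ 2 + 4 * \<delta> ^ 3 + \<delta> ^ 4"
          by (simp add: power4_eq_xxxx power2_eq_square power3_eq_cube algebra_simps)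
        ultimately show ?thesis by linarith
      qed
      also have "1 + 15 * \<delta> \<le> 1 + \<epsilon>" using \<delta> by simp
      finally have "(\<bar>u\<bar> + \<bar>w\<bar>) ^ 4 \<le> (1 + \<epsilon>) * \<bar>u\<bar> ^ 4"
        by (simp add: mult_right_mono)
      moreover have "0 \<le> (1 + 1 / \<delta>) ^ 4 * w ^ 4" using \<delta> by simp
      moreover have "(1 + \<epsilon>) * \<bar>u\<bar> ^ 4 = u ^ 4 + \<epsilon> * u ^ 4" by (simp add: a4 distrib_right)
      ultimately show ?thesis using le unfolding a4 by linarith
    next
      case False
      then have "\<bar>u\<bar> \<le> 1 / \<delta> * \<bar>w\<bar>" using \<delta> by (simp add: field_simps)
      then have "(\<bar>u\<bar> + \<bar>w\<bar>) ^ 4 \<le> ((1 + 1 / \<delta>) * \<bar>w\<bar>) ^ 4"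
        by (intro power_mono) (auto simp: algebra_simps)
      also have "\<dots> = (1 + 1 / \<delta>) ^ 4 * w ^ 4" by (simp only: power_mult_distrib a4)
      finally have "(\<bar>u\<bar> + \<bar>w\<bar>) ^ 4 \<le> (1 + 1 / \<delta>) ^ 4 * w ^ 4" .
      moreover have "0 \<le> \<epsilon> * u ^ 4" "0 \<le> u ^ 4" using assms by simp_all
      ultimately show ?thesis using le unfolding a4 by linarith
    qed
  qed
  moreover have "0 \<le> (1 + 1 / \<delta>) ^ 4" using \<delta> by simp
  ultimately show ?thesis by blast
qed

text \<open>Each term is at most the largest one, whose fourth power is itself one of the summands
  on the right.\<close>

lemma power4_sum_le:
  fixes f :: "'i \<Rightarrow> real"
  assumes "finite A" "\<And>i. i \<in> A \<Longrightarrow> 0 \<le> f i"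
  shows "(\<Sum>i\<in>A. f i) ^ 4 \<le> real (card A) ^ 4 * (\<Sum>i\<in>A. f i ^ 4)"
proof (cases "A = {}")
  case False
  define M where "M = Max (f ` A)"
  have M: "f i \<le> M" if "i \<in> A" for i using that assms(1) by (simp add: M_def)
  have "M \<in> f ` A" unfolding M_def using assms(1) False by (intro Max_in) auto
  then obtain j where j: "j \<in> A" "M = f j" by auto
  have "(\<Sum>i\<in>A. f i) \<le> real (card A) * M" using sum_bounded_above[of A f M] M by simp
  then have "(\<Sum>i\<in>A. f i) ^ 4 \<le> (real (card A) * M) ^ 4"
    using assms(2) by (intro power_mono) (auto intro: sum_nonneg)
  also have "\<dots> = real (card A) ^ 4 * f j ^ 4" by (simp add: power_mult_distrib j)
  also have "\<dots> \<le> real (card A) ^ 4 * (\<Sum>i\<in>A. f i ^ 4)"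
    using assms j by (intro mult_left_mono member_le_sum) auto
  finally show ?thesis .
qed simp

lemma sum_int_symmetric:
  fixes f :: "int \<Rightarrow> 'b :: comm_monoid_add"
  shows "(\<Sum>m = - int l..int l. f m) = f 0 + (\<Sum>m = 1..l. f (int m) + f (- int m))"
proof (induction l)
  case (Suc l)
  have "{- int (Suc l)..int (Suc l)} = insert (- int (Suc l)) (insert (int (Suc l)) {- int l..int l})"
    by auto
  then have "(\<Sum>m = - int (Suc l)..int (Suc l). f m)
      = f (- int (Suc l)) + (f (int (Suc l)) + (\<Sum>m = - int l..int l. f m))"
    by (simp del: of_nat_Suc)
  then show ?case by (simp only: Suc.IH) (simp add: ac_simps del: of_nat_Suc)
qed simp

lemma soft_of_real: "soft lam (of_real r) = of_real (Re (soft lam (of_real r)))"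
  by (simp add: soft_def)

section \<open>Zonal and nonzonal parts of a regularized multipole, for a fixed expansion\<close>

locale regularized_field = prob_space M for M :: "'w measure" +
  fixes C :: "nat \<Rightarrow> real" and lam :: real and T :: "'w \<Rightarrow> real ^ 3 \<Rightarrow> real"
    and a :: "nat \<Rightarrow> int \<Rightarrow> 'w \<Rightarrow> complex"
  assumes coeffs: "gaussian_isotropic_coeffs M C a"
    and joint_measurable: "(\<lambda>(\<omega>, x). T \<omega> x) \<in> borel_measurable (M \<Otimes>\<^sub>M restrict_space borel (sphere 0 1))"
    and square_integrable: "\<And>\<omega>. \<omega> \<in> space M \<Longrightarrow> square_integrable_on_sphere (T \<omega>)"
    and expansion: "AE \<omega> in M. residual (T \<omega>) (\<lambda>l m. a l m \<omega>) \<longlonglongrightarrow> 0"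
    and C_pos: "\<And>l. 0 < C l" and lam_pos: "0 < lam"
begin

lemma measurable_coeff [measurable]: "\<bar>m\<bar> \<le> int l \<Longrightarrow> a l m \<in> borel_measurable M"
  using coeffs unfolding gaussian_isotropic_coeffs_def by blast

lemma reg_multipole_eq:
  assumes "\<omega> \<in> space M"
  shows "reg_multipole lam T l p \<omega>
    = (\<Sum>m = - int l..int l. soft lam (sph_coeff (T \<omega>) l m) * sph_harm l m p)"
  unfolding reg_multipole_def multipole_def
  using reg_coeffs_eq_soft[OF square_integrable[OF assms] lam_pos] by (intro sum.cong refl) auto

text \<open>\<open>reg_coeffs\<close> is chosen separately for each realization, so measurability
  has to come from the explicit soft-thresholding formula.\<close>

lemma measurable_reg_multipole [measurable]: "reg_multipole lam T l p \<in> borel_measurable M"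
proof -
  have "(\<lambda>\<omega>. \<Sum>m = - int l..int l. soft lam (sph_coeff (T \<omega>) l m) * sph_harm l m p) \<in> borel_measurable M"
    by (intro borel_measurable_sum borel_measurable_times borel_measurable_const
        measurable_compose[OF measurable_sph_coeff[OF joint_measurable] measurable_soft])
  then show ?thesis by (subst measurable_cong[OF reg_multipole_eq])
qed

text \<open>Using \<open>Re\<close> makes this a real variable at every realization; the coefficient
  of order 0 itself is real only almost surely.\<close>

definition zonal :: "nat \<Rightarrow> 'w \<Rightarrow> real" where
  "zonal l \<omega> = Re (soft lam (of_real (Re (a l 0 \<omega>))))"

text \<open>Almost surely the orders m and -m contribute conjugate terms, which explains the doubled
  real part and the restriction to positive orders.\<close>

definition nonzonal :: "nat \<Rightarrow> real \<times> real \<Rightarrow> 'w \<Rightarrow> real" where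
  "nonzonal l p \<omega> = (\<Sum>m = 1..l. 2 * Re (soft lam (a l (int m) \<omega>) * sph_harm l (int m) p))"

lemma measurable_zonal [measurable]: "zonal l \<in> borel_measurable M"
  unfolding zonal_def by measurable

lemma measurable_nonzonal [measurable]: "nonzonal l p \<in> borel_measurable M"
  unfolding nonzonal_def
proof (intro borel_measurable_sum borel_measurable_times borel_measurable_const)
  fix m assume "m \<in> {1..l}"
  then have [measurable]: "a l (int m) \<in> borel_measurable M" by (intro measurable_coeff) auto
  show "(\<lambda>\<omega>. Re (soft lam (a l (int m) \<omega>) * sph_harm l (int m) p)) \<in> borel_measurable M"
    by measurable
qed

lemma AE_reg_multipole:
  "AE \<omega> in M. reg_multipole lam T l (\<theta>, \<phi>) \<omega>
    = of_real (sph_norm l * poly (legendre l) (cos \<theta>) * zonal l \<omega> + nonzonal l (\<theta>, \<phi>) \<omega>)"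
proof -
  have "AE \<omega> in M. \<forall>m\<in>{- int l..int l}. a l (- m) \<omega> = (-1) ^ nat \<bar>m\<bar> * cnj (a l m \<omega>)"
    using coeffs unfolding gaussian_isotropic_coeffs_def
    by (intro AE_finite_allI) auto
  with expansion AE_space show ?thesis
  proof eventually_elim
    case (elim \<omega>)
    have c: "sph_coeff (T \<omega>) l m = a l m \<omega>" if "\<bar>m\<bar> \<le> int l" for m
      using residual_zero_imp_coeff[OF square_integrable elim(1)] elim(2) that by auto
    define f where "f m = soft lam (a l m \<omega>) * sph_harm l m (\<theta>, \<phi>)" for m
    have R: "reg_multipole lam T l (\<theta>, \<phi>) \<omega> = (\<Sum>m = - int l..int l. f m)"
      unfolding reg_multipole_eq[OF elim(2)] f_def by (intro sum.cong refl) (auto simp: c)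
    have s: "a l (- m) \<omega> = (-1) ^ nat \<bar>m\<bar> * cnj (a l m \<omega>)" if "\<bar>m\<bar> \<le> int l" for m
      using elim(3) that by (auto simp: abs_le_iff)
    have "a l 0 \<omega> = cnj (a l 0 \<omega>)" using s[of 0] by simp
    then have "a l 0 \<omega> = of_real (Re (a l 0 \<omega>))" by (simp add: complex_eq_iff)
    then have "soft lam (a l 0 \<omega>) = of_real (zonal l \<omega>)"
      unfolding zonal_def soft_of_real[symmetric] by simp
    then have f0: "f 0 = of_real (sph_norm l * poly (legendre l) (cos \<theta>) * zonal l \<omega>)"
      by (simp add: f_def sph_harm_0 mult_ac)
    have "f (int m) + f (- int m) = of_real (2 * Re (f (int m)))" if "m \<in> {1..l}" for m
    proof -
      \<comment> \<open>One sign comes from the coefficient, through the equivariance of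
        \<open>soft\<close>, and the other from the harmonic; they cancel.\<close>
      have "f (- int m) = ((-1) ^ m * (-1) ^ m) * cnj (f (int m))"
        using that s[of "int m"] by (simp add: f_def sph_harm_uminus soft_sign soft_cnj mult_ac)
      then have "f (- int m) = cnj (f (int m))" by (simp flip: power_add mult_2)
      then show ?thesis by (simp add: complex_add_cnj)
    qed
    then have "(\<Sum>m = 1..l. f (int m) + f (- int m)) = of_real (nonzonal l (\<theta>, \<phi>) \<omega>)"
      unfolding nonzonal_def of_real_sum f_def by (intro sum.cong refl) simp
    with f0 show ?case unfolding R sum_int_symmetric by simp
  qed
qed

lemma zonal_moment:
  shows "integrable M (\<lambda>\<omega>. zonal l \<omega> ^ (2 * k))"
    and "sqrt (C l) ^ (2 * k) * exp (- (lam / sqrt (C l) + 2)\<^sup>2 / 2) / sqrt (2 * pi)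
      \<le> expectation (\<lambda>\<omega>. zonal l \<omega> ^ (2 * k))"
proof -
  have d: "distributed M lborel (\<lambda>\<omega>. Re (a l 0 \<omega>)) (normal_density 0 (sqrt (C l)))"
    using coeffs unfolding gaussian_isotropic_coeffs_def by blast
  have "cmod (soft lam (of_real (Re (a l 0 \<omega>)))) = \<bar>zonal l \<omega>\<bar>" for \<omega>
    unfolding zonal_def by (subst soft_of_real) (simp only: norm_of_real)
  then have eq: "cmod (soft lam (of_real (Re (a l 0 \<omega>)))) ^ (2 * k) = zonal l \<omega> ^ (2 * k)" for \<omega>
    by (simp add: power_even_abs)
  show "integrable M (\<lambda>\<omega>. zonal l \<omega> ^ (2 * k))"
      "sqrt (C l) ^ (2 * k) * exp (- (lam / sqrt (C l) + 2)\<^sup>2 / 2) / sqrt (2 * pi)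
      \<le> expectation (\<lambda>\<omega>. zonal l \<omega> ^ (2 * k))"
    using soft_real_gaussian[OF C_pos lam_pos d, of "2 * k"] unfolding eq by auto
qed

lemma zonal_moment_pos: "0 < expectation (\<lambda>\<omega>. zonal l \<omega> ^ (2 * k))"
proof (rule less_le_trans[OF _ zonal_moment(2)])
  show "0 < sqrt (C l) ^ (2 * k) * exp (- (lam / sqrt (C l) + 2)\<^sup>2 / 2) / sqrt (2 * pi)"
    using C_pos[of l] by simp
qed

text \<open>The triangle inequality and the uniform bound on the harmonics reduce this to l single
  coefficients. The power l^5 is l^4 from \<open>power4_sum_le\<close> times the number of
  terms.\<close>

lemma nonzonal_moment:
  shows "integrable M (\<lambda>\<omega>. nonzonal l p \<omega> ^ 4)"
    and "expectation (\<lambda>\<omega>. nonzonal l p \<omega> ^ 4)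
      \<le> (2 * (sph_norm l * real (2 * l) ^ (2 * l))) ^ 4 * real l ^ 5
          * (3200 * (C l)\<^sup>2 * exp (- (7 / 10) * (lam\<^sup>2 / C l)))"
proof -
  let ?B = "sph_norm l * real (2 * l) ^ (2 * l)"
  let ?s = "\<lambda>m \<omega>. cmod (soft lam (a l (int m) \<omega>))"
  let ?e = "3200 * (C l)\<^sup>2 * exp (- (7 / 10) * (lam\<^sup>2 / C l))"
  have B: "0 \<le> ?B" using sph_norm_pos[of l] by simp
  have s: "integrable M (\<lambda>\<omega>. ?s m \<omega> ^ 4) \<and> expectation (\<lambda>\<omega>. ?s m \<omega> ^ 4) \<le> ?e" if "m \<in> {1..l}" for m
  proof -
    have m: "int m \<noteq> 0" "\<bar>int m\<bar> \<le> int l" using that by auto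
    show ?thesis
      using coeffs m soft_complex_gaussian[OF C_pos[of l] lam_pos measurable_coeff[OF m(2)]]
      unfolding gaussian_isotropic_coeffs_def by blast
  qed
  have le: "nonzonal l p \<omega> ^ 4 \<le> (2 * ?B) ^ 4 * (real l ^ 4 * (\<Sum>m = 1..l. ?s m \<omega> ^ 4))" for \<omega>
  proof -
    have "\<bar>nonzonal l p \<omega>\<bar> \<le> (\<Sum>m = 1..l. \<bar>2 * Re (soft lam (a l (int m) \<omega>) * sph_harm l (int m) p)\<bar>)"
      unfolding nonzonal_def by (rule sum_abs)
    also have "\<dots> \<le> (\<Sum>m = 1..l. 2 * ?B * ?s m \<omega>)"
    proof (intro sum_mono)
      fix m assume "m \<in> {1..l}"
      then have "cmod (sph_harm l (int m) p) \<le> ?B" by (intro norm_sph_harm_le) auto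
      then have "?s m \<omega> * cmod (sph_harm l (int m) p) \<le> ?s m \<omega> * ?B" by (rule mult_left_mono) simp
      moreover have "\<bar>Re (soft lam (a l (int m) \<omega>) * sph_harm l (int m) p)\<bar> \<le> ?s m \<omega> * cmod (sph_harm l (int m) p)"
        using abs_Re_le_cmod[of "soft lam (a l (int m) \<omega>) * sph_harm l (int m) p"] by (simp only: norm_mult)
      ultimately have "\<bar>Re (soft lam (a l (int m) \<omega>) * sph_harm l (int m) p)\<bar> \<le> ?s m \<omega> * ?B"
        by (rule order_trans[rotated])
      then show "\<bar>2 * Re (soft lam (a l (int m) \<omega>) * sph_harm l (int m) p)\<bar> \<le> 2 * ?B * ?s m \<omega>"
        by (simp only: abs_mult abs_numeral) (simp only: mult_ac mult_le_cancel_left_pos zero_less_numeral)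
    qed
    also have "\<dots> = 2 * ?B * (\<Sum>m = 1..l. ?s m \<omega>)" by (simp only: sum_distrib_left)
    finally have "\<bar>nonzonal l p \<omega>\<bar> ^ 4 \<le> (2 * ?B * (\<Sum>m = 1..l. ?s m \<omega>)) ^ 4"
      by (rule power_mono) simp
    also have "\<dots> = (2 * ?B) ^ 4 * (\<Sum>m = 1..l. ?s m \<omega>) ^ 4" by (rule power_mult_distrib)
    also have "\<dots> \<le> (2 * ?B) ^ 4 * (real l ^ 4 * (\<Sum>m = 1..l. ?s m \<omega> ^ 4))"
      using power4_sum_le[of "{1..l}" "\<lambda>m. ?s m \<omega>"] B by (intro mult_left_mono) auto
    finally show ?thesis by (simp only: power_even_abs_numeral even_numeral)
  qed
  have i: "integrable M (\<lambda>\<omega>. (2 * ?B) ^ 4 * (real l ^ 4 * (\<Sum>m = 1..l. ?s m \<omega> ^ 4)))"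
    using s by (intro integrable_mult_right Bochner_Integration.integrable_sum) auto
  show I: "integrable M (\<lambda>\<omega>. nonzonal l p \<omega> ^ 4)"
    by (rule Bochner_Integration.integrable_bound[OF i])
      (measurable, intro AE_I2, use le in \<open>auto intro: order_trans[OF le]\<close>)
  have "expectation (\<lambda>\<omega>. nonzonal l p \<omega> ^ 4)
      \<le> expectation (\<lambda>\<omega>. (2 * ?B) ^ 4 * (real l ^ 4 * (\<Sum>m = 1..l. ?s m \<omega> ^ 4)))"
    by (intro integral_mono I i le)
  also have "\<dots> = (2 * ?B) ^ 4 * (real l ^ 4 * (\<Sum>m = 1..l. expectation (\<lambda>\<omega>. ?s m \<omega> ^ 4)))"
    using s by (simp only: integral_mult_right_zero) (subst Bochner_Integration.integral_sum, auto)
  also have "\<dots> \<le> (2 * ?B) ^ 4 * (real l ^ 4 * (\<Sum>m = 1..l. ?e))"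
    using s B by (intro mult_left_mono sum_mono) auto
  also have "\<dots> = (2 * ?B) ^ 4 * real l ^ 5 * ?e"
    by (simp add: power_Suc2[of "real l" 4, simplified] mult_ac)
  finally show "expectation (\<lambda>\<omega>. nonzonal l p \<omega> ^ 4) \<le> (2 * ?B) ^ 4 * real l ^ 5 * ?e" .
qed

lemma nonzonal_north_pole: "nonzonal l (0, 0) \<omega> = 0"
  unfolding nonzonal_def by (intro sum.neutral) (simp add: sph_harm_north_pole)

lemma expectation_reg_multipole_power:
  "(\<integral>\<omega>. reg_multipole lam T l (\<theta>, \<phi>) \<omega> ^ k \<partial>M)
    = of_real (expectation (\<lambda>\<omega>. (sph_norm l * poly (legendre l) (cos \<theta>) * zonal l \<omega> + nonzonal l (\<theta>, \<phi>) \<omega>) ^ k))"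
proof -
  have "(\<integral>\<omega>. reg_multipole lam T l (\<theta>, \<phi>) \<omega> ^ k \<partial>M)
    = (\<integral>\<omega>. of_real ((sph_norm l * poly (legendre l) (cos \<theta>) * zonal l \<omega> + nonzonal l (\<theta>, \<phi>) \<omega>) ^ k) \<partial>M)"
  proof (rule integral_cong_AE)
    show "AE \<omega> in M. reg_multipole lam T l (\<theta>, \<phi>) \<omega> ^ k
       = of_real ((sph_norm l * poly (legendre l) (cos \<theta>) * zonal l \<omega> + nonzonal l (\<theta>, \<phi>) \<omega>) ^ k)"
      using AE_reg_multipole[of l \<theta> \<phi>] by eventually_elim simp
  qed measurable
  then show ?thesis by (simp only: integral_complex_of_real)
qed

text \<open>Both kurtoses are normalized by the same nonzero second moment at the pole, which
  cancels. Since the nonzonal part vanishes there and P_l(1) = 1, the remaining denominator is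
  exactly the fourth moment of the zonal term at the given angle.\<close>

lemma kappa_ratio_eq:
  assumes "poly (legendre l) (cos \<theta>) \<noteq> 0"
  shows "kappa_ratio M lam T (\<theta>, \<phi>) l = of_real
    (expectation (\<lambda>\<omega>. (sph_norm l * poly (legendre l) (cos \<theta>) * zonal l \<omega> + nonzonal l (\<theta>, \<phi>) \<omega>) ^ 4)
      / expectation (\<lambda>\<omega>. (sph_norm l * poly (legendre l) (cos \<theta>) * zonal l \<omega>) ^ 4))"
proof -
  let ?P = "poly (legendre l) (cos \<theta>)"
  have pole: "(\<integral>\<omega>. reg_multipole lam T l (0, 0) \<omega> ^ k \<partial>M) = of_real (sph_norm l ^ k * expectation (\<lambda>\<omega>. zonal l \<omega> ^ k))" for k
    unfolding expectation_reg_multipole_power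
    by (simp add: nonzonal_north_pole poly_legendre_1 power_mult_distrib)
  have "sph_norm l ^ 2 * expectation (\<lambda>\<omega>. zonal l \<omega> ^ 2) \<noteq> 0"
    using zonal_moment_pos[of l 1] sph_norm_pos[of l] by simp
  then have D: "(\<integral>\<omega>. reg_multipole lam T l (0, 0) \<omega> ^ 2 \<partial>M)\<^sup>2 \<noteq> 0"
    unfolding pole by simp
  have "kappa_ratio M lam T (\<theta>, \<phi>) l = (\<integral>\<omega>. reg_multipole lam T l (\<theta>, \<phi>) \<omega> ^ 4 \<partial>M)
      / ((\<integral>\<omega>. reg_multipole lam T l (0, 0) \<omega> ^ 4 \<partial>M) * of_real (?P ^ 4))"
    using D unfolding kappa_ratio_def kappa_def by simp
  moreover have "expectation (\<lambda>\<omega>. (sph_norm l * ?P * zonal l \<omega>) ^ 4)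
     = sph_norm l ^ 4 * expectation (\<lambda>\<omega>. zonal l \<omega> ^ 4) * ?P ^ 4"
    by (simp add: power_mult_distrib)
  ultimately show ?thesis
    unfolding pole expectation_reg_multipole_power by simp
qed

text \<open>Here 51200 = 2^4 * 3200. In the exponent, 16 bounds the fourth power of (2l)^(2l), 5
  bounds l^5, and 4 b pays for inserting P_l^4 at a regular degree.\<close>

lemma nonzonal_le_zonal:
  defines "s \<equiv> \<lambda>l. lam / sqrt (C l)"
  assumes "l \<in> regular_degrees b \<theta>"
  shows "expectation (\<lambda>\<omega>. nonzonal l (\<theta>, \<phi>) \<omega> ^ 4)
    \<le> 51200 * sqrt (2 * pi) * exp 12 * exp ((21 + 4 * b) * (real l)\<^sup>2 - (s l)\<^sup>2 / 10)
      * expectation (\<lambda>\<omega>. (sph_norm l * poly (legendre l) (cos \<theta>) * zonal l \<omega>) ^ 4)"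
proof -
  let ?P = "poly (legendre l) (cos \<theta>)" and ?E = "expectation (\<lambda>\<omega>. zonal l \<omega> ^ 4)"
  have s2: "lam\<^sup>2 / C l = (s l)\<^sup>2" using C_pos[of l] by (simp add: s_def power_divide)
  have "sqrt (C l) ^ 4 = (C l)\<^sup>2" using C_pos[of l] by (simp add: power4_eq_xxxx power2_eq_square)
  then have E: "(C l)\<^sup>2 * exp (- (s l + 2)\<^sup>2 / 2) / sqrt (2 * pi) \<le> ?E"
    using zonal_moment(2)[of l 2] by (simp add: s_def)
  have "(C l)\<^sup>2 * exp (- (7 / 10) * (s l)\<^sup>2)
      = (C l)\<^sup>2 * exp (- (s l + 2)\<^sup>2 / 2) / sqrt (2 * pi) * (sqrt (2 * pi) * exp (- (7 / 10) * (s l)\<^sup>2 + (s l + 2)\<^sup>2 / 2))"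
  proof -
    have "exp (- (s l + 2)\<^sup>2 / 2) * exp (- (7 / 10) * (s l)\<^sup>2 + (s l + 2)\<^sup>2 / 2) = exp (- (7 / 10) * (s l)\<^sup>2)"
      by (simp flip: exp_add)
    from this[symmetric] show ?thesis by (simp only:) simp
  qed
  also have "\<dots> \<le> ?E * (sqrt (2 * pi) * exp (12 - (s l)\<^sup>2 / 10))"
  proof (intro mult_mono E mult_left_mono)
    \<comment> \<open>The exponent on the left is -s^2/5 + 2 s + 2. A tenth of this square bounds 2
      s by s^2/10 + 10, leaving 12 - s^2/10.\<close>
    have "0 \<le> (s l - 10)\<^sup>2" by simp
    then show "exp (- (7 / 10) * (s l)\<^sup>2 + (s l + 2)\<^sup>2 / 2) \<le> exp (12 - (s l)\<^sup>2 / 10)"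
      by (simp add: power2_eq_square algebra_simps)
    show "0 \<le> ?E" by (intro integral_nonneg_AE) simp
  qed auto
  finally have 1: "(C l)\<^sup>2 * exp (- (7 / 10) * (s l)\<^sup>2) \<le> ?E * (sqrt (2 * pi) * exp (12 - (s l)\<^sup>2 / 10))" .
  have pw: "real n \<le> exp (real n)" for n
    using exp_ge_add_one_self[of "real n"] by linarith
  have B: "(real (2 * l) ^ (2 * l)) ^ 4 \<le> exp (16 * (real l)\<^sup>2)"
  proof -
    have "(real (2 * l) ^ (2 * l)) ^ 4 \<le> (exp (real (2 * l)) ^ (2 * l)) ^ 4"
      by (intro power_mono pw) auto
    also have "\<dots> = exp (16 * (real l)\<^sup>2)"
      by (simp add: power2_eq_square algebra_simps flip: exp_of_nat_mult power_mult)
    finally show ?thesis .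
  qed
  have L: "real l ^ 5 \<le> exp (5 * (real l)\<^sup>2)"
  proof -
    have "real l ^ 5 \<le> exp (real l) ^ 5" by (intro power_mono pw) auto
    also have "\<dots> = exp (5 * real l)" by (simp flip: exp_of_nat_mult)
    also have "\<dots> \<le> exp (5 * (real l)\<^sup>2)"
      by (simp add: power2_eq_square le_square flip: of_nat_mult)
    finally show ?thesis .
  qed
  have P: "1 \<le> exp (4 * b * (real l)\<^sup>2) * ?P ^ 4"
  proof -
    have "exp (- b * (real l)\<^sup>2) ^ 4 \<le> \<bar>?P\<bar> ^ 4"
      using assms(2) by (intro power_mono) (auto simp: regular_degrees_def)
    moreover have "exp (- b * (real l)\<^sup>2) ^ 4 = exp (- (4 * b * (real l)\<^sup>2))"
      by (simp flip: exp_of_nat_mult)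
    ultimately have "exp (- (4 * b * (real l)\<^sup>2)) \<le> ?P ^ 4" by (simp add: power_even_abs)
    then have "exp (4 * b * (real l)\<^sup>2) * exp (- (4 * b * (real l)\<^sup>2)) \<le> exp (4 * b * (real l)\<^sup>2) * ?P ^ 4"
      by (rule mult_left_mono) simp
    then show ?thesis by (simp flip: exp_add)
  qed
  have c: "0 \<le> sph_norm l" using sph_norm_pos[of l] by simp
  have "expectation (\<lambda>\<omega>. nonzonal l (\<theta>, \<phi>) \<omega> ^ 4)
      \<le> 51200 * sph_norm l ^ 4 * ((real (2 * l) ^ (2 * l)) ^ 4 * (real l ^ 5 * ((C l)\<^sup>2 * exp (- (7 / 10) * (s l)\<^sup>2))))"
    using nonzonal_moment(2)[of l "(\<theta>, \<phi>)"] unfolding s2 power_mult_distrib by (simp add: mult_ac)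
  also have "\<dots> \<le> 51200 * sph_norm l ^ 4 * (exp (16 * (real l)\<^sup>2) * (exp (5 * (real l)\<^sup>2)
      * (?E * (sqrt (2 * pi) * exp (12 - (s l)\<^sup>2 / 10)))))"
    using c by (intro mult_left_mono mult_mono B L 1) auto
  also have "\<dots> \<le> 51200 * sph_norm l ^ 4 * (exp (16 * (real l)\<^sup>2) * (exp (5 * (real l)\<^sup>2)
      * (?E * (sqrt (2 * pi) * exp (12 - (s l)\<^sup>2 / 10))))) * (exp (4 * b * (real l)\<^sup>2) * ?P ^ 4)"
  proof -
    have "0 \<le> ?E" by (intro integral_nonneg_AE) simp
    then have "0 \<le> 51200 * sph_norm l ^ 4 * (exp (16 * (real l)\<^sup>2) * (exp (5 * (real l)\<^sup>2)
      * (?E * (sqrt (2 * pi) * exp (12 - (s l)\<^sup>2 / 10)))))" using c by simp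
    from mult_left_mono[OF P this] show ?thesis by simp
  qed
  also have "\<dots> = 51200 * sqrt (2 * pi) * exp 12 * exp ((21 + 4 * b) * (real l)\<^sup>2 - (s l)\<^sup>2 / 10)
      * (sph_norm l ^ 4 * ?P ^ 4 * ?E)"
  proof -
    have "exp (16 * (real l)\<^sup>2) * exp (5 * (real l)\<^sup>2) * exp (12 - (s l)\<^sup>2 / 10) * exp (4 * b * (real l)\<^sup>2)
        = exp 12 * exp ((21 + 4 * b) * (real l)\<^sup>2 - (s l)\<^sup>2 / 10)"
      by (simp add: algebra_simps flip: exp_add)
    then show ?thesis by algebra
  qed
  also have "sph_norm l ^ 4 * ?P ^ 4 * ?E = expectation (\<lambda>\<omega>. (sph_norm l * ?P * zonal l \<omega>) ^ 4)"
    by (simp add: power_mult_distrib)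
  finally show ?thesis .
qed

text \<open>Integrate the pointwise perturbation bound and divide by the fourth moment of the zonal
  term, which is positive because P_l does not vanish at a regular degree.\<close>

lemma kappa_ratio_bound:
  assumes K: "\<And>u w :: real. \<bar>(u + w) ^ 4 - u ^ 4\<bar> \<le> \<epsilon> * u ^ 4 + K * w ^ 4" "0 \<le> K"
    and l: "l \<in> regular_degrees b \<theta>"
  shows "dist (kappa_ratio M lam T (\<theta>, \<phi>) l) 1
    \<le> \<epsilon> + K * (51200 * sqrt (2 * pi) * exp 12 * exp ((21 + 4 * b) * (real l)\<^sup>2 - (lam / sqrt (C l))\<^sup>2 / 10))"
proof -
  let ?P = "poly (legendre l) (cos \<theta>)"
  let ?Q = "51200 * sqrt (2 * pi) * exp 12 * exp ((21 + 4 * b) * (real l)\<^sup>2 - (lam / sqrt (C l))\<^sup>2 / 10)"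
  define U where "U \<omega> = sph_norm l * ?P * zonal l \<omega>" for \<omega>
  define W where "W = nonzonal l (\<theta>, \<phi>)"
  have Um [measurable]: "U \<in> borel_measurable M" "W \<in> borel_measurable M"
    unfolding U_def W_def by measurable
  have P: "?P \<noteq> 0"
  proof
    assume "?P = 0"
    then have "exp (- b * (real l)\<^sup>2) \<le> 0" using l by (simp add: regular_degrees_def)
    then show False using exp_gt_zero not_le by blast
  qed
  have U4: "U \<omega> ^ 4 = (sph_norm l * ?P) ^ 4 * zonal l \<omega> ^ 4" for \<omega>
    by (simp only: U_def power_mult_distrib)
  have iU: "integrable M (\<lambda>\<omega>. U \<omega> ^ 4)"
    unfolding U4 using zonal_moment(1)[of l 2] by (intro integrable_mult_right) simp
  have iW: "integrable M (\<lambda>\<omega>. W \<omega> ^ 4)" unfolding W_def by (rule nonzonal_moment(1))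
  have EU: "0 < expectation (\<lambda>\<omega>. U \<omega> ^ 4)"
    unfolding U4 using zonal_moment_pos[of l 2] P sph_norm_pos[of l] by (simp add: zero_less_mult_iff)
  have ib: "integrable M (\<lambda>\<omega>. \<epsilon> * U \<omega> ^ 4 + K * W \<omega> ^ 4)" using iU iW by simp
  have iD: "integrable M (\<lambda>\<omega>. (U \<omega> + W \<omega>) ^ 4 - U \<omega> ^ 4)"
  proof (rule Bochner_Integration.integrable_bound[OF ib])
    show "AE \<omega> in M. norm ((U \<omega> + W \<omega>) ^ 4 - U \<omega> ^ 4) \<le> norm (\<epsilon> * U \<omega> ^ 4 + K * W \<omega> ^ 4)"
      by (intro AE_I2) (simp only: real_norm_def, rule order_trans[OF K(1) abs_ge_self])
  qed measurable
  have "integrable M (\<lambda>\<omega>. ((U \<omega> + W \<omega>) ^ 4 - U \<omega> ^ 4) + U \<omega> ^ 4)"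
    by (rule Bochner_Integration.integrable_add[OF iD iU])
  then have iUW: "integrable M (\<lambda>\<omega>. (U \<omega> + W \<omega>) ^ 4)" by simp
  have "\<bar>expectation (\<lambda>\<omega>. (U \<omega> + W \<omega>) ^ 4) - expectation (\<lambda>\<omega>. U \<omega> ^ 4)\<bar>
      = \<bar>expectation (\<lambda>\<omega>. (U \<omega> + W \<omega>) ^ 4 - U \<omega> ^ 4)\<bar>" using iUW iU by simp
  also have "\<dots> \<le> expectation (\<lambda>\<omega>. \<bar>(U \<omega> + W \<omega>) ^ 4 - U \<omega> ^ 4\<bar>)" by (rule integral_abs_bound)
  also have "\<dots> \<le> expectation (\<lambda>\<omega>. \<epsilon> * U \<omega> ^ 4 + K * W \<omega> ^ 4)"
    using iD ib K(1) by (intro integral_mono) auto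
  also have "\<dots> = \<epsilon> * expectation (\<lambda>\<omega>. U \<omega> ^ 4) + K * expectation (\<lambda>\<omega>. W \<omega> ^ 4)"
    using iU iW by simp
  also have "\<dots> \<le> \<epsilon> * expectation (\<lambda>\<omega>. U \<omega> ^ 4) + K * (?Q * expectation (\<lambda>\<omega>. U \<omega> ^ 4))"
    using nonzonal_le_zonal[OF l, of \<phi>] K(2) unfolding U_def W_def
    by (intro add_left_mono mult_left_mono) auto
  finally have "\<bar>expectation (\<lambda>\<omega>. (U \<omega> + W \<omega>) ^ 4) - expectation (\<lambda>\<omega>. U \<omega> ^ 4)\<bar>
      \<le> (\<epsilon> + K * ?Q) * expectation (\<lambda>\<omega>. U \<omega> ^ 4)" by (simp add: algebra_simps)
  then have "\<bar>expectation (\<lambda>\<omega>. (U \<omega> + W \<omega>) ^ 4) / expectation (\<lambda>\<omega>. U \<omega> ^ 4) - 1\<bar> \<le> \<epsilon> + K * ?Q"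
    using EU by (simp add: field_simps abs_le_iff)
  moreover have "dist (kappa_ratio M lam T (\<theta>, \<phi>) l) 1
      = \<bar>expectation (\<lambda>\<omega>. (U \<omega> + W \<omega>) ^ 4) / expectation (\<lambda>\<omega>. U \<omega> ^ 4) - 1\<bar>"
  proof -
    have "dist (complex_of_real x) 1 = \<bar>x - 1\<bar>" for x
      by (metis dist_of_real dist_real_def of_real_1)
    then show ?thesis unfolding kappa_ratio_eq[OF P] U_def W_def .
  qed
  ultimately show ?thesis by simp
qed

end

text \<open>Here \<alpha> > 2 enters: eventually k l^(\<alpha> - 2) exceeds c + 1, so the exponent
  is at most -l^2 \<le> -l and a geometric sequence dominates.\<close>

lemma exp_quadratic_minus_powr_tendsto_0:
  fixes c k \<alpha> :: real
  assumes "0 < k" "2 < \<alpha>"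
  shows "(\<lambda>l. exp (c * (real l)\<^sup>2 - k * real l powr \<alpha>)) \<longlonglongrightarrow> 0"
proof -
  have "filterlim (\<lambda>l. exp ((\<alpha> - 2) * ln (real l))) at_top sequentially"
    using assms
    by (intro filterlim_compose[OF exp_at_top] filterlim_tendsto_pos_mult_at_top[OF tendsto_const]
        filterlim_compose[OF ln_at_top filterlim_real_sequentially]) simp
  then have "filterlim (\<lambda>l. real l powr (\<alpha> - 2)) at_top sequentially"
    by (rule filterlim_cong[THEN iffD1, OF refl refl, rotated])
      (use eventually_gt_at_top[of 0] in eventually_elim, simp add: powr_def)
  then have "eventually (\<lambda>l. (c + 1) / k \<le> real l powr (\<alpha> - 2)) sequentially"
    by (simp add: filterlim_at_top)
  then have ev: "eventually (\<lambda>l. norm (exp (c * (real l)\<^sup>2 - k * real l powr \<alpha>)) \<le> exp (- 1) ^ l) sequentially"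
    using eventually_ge_at_top[of 1]
  proof eventually_elim
    case (elim l)
    then have "c + 1 \<le> k * real l powr (\<alpha> - 2)" using assms by (simp add: field_simps)
    then have "(c + 1) * (real l)\<^sup>2 \<le> k * real l powr (\<alpha> - 2) * (real l)\<^sup>2"
      by (rule mult_right_mono) simp
    also have "\<dots> = k * real l powr \<alpha>"
    proof -
      have "real l powr \<alpha> = real l powr (\<alpha> - 2) * real l powr 2"
        by (subst powr_add[symmetric]) simp
      also have "real l powr 2 = (real l)\<^sup>2" using elim by simp
      finally show ?thesis by simp
    qed
    finally have "c * (real l)\<^sup>2 - k * real l powr \<alpha> \<le> - ((real l)\<^sup>2)" by (simp add: algebra_simps)
    also have "\<dots> \<le> - real l" using elim by (simp add: power2_eq_square)
    finally show ?case by (simp flip: exp_of_nat_mult)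
  qed
  have "(\<lambda>l. exp (- 1 :: real) ^ l) \<longlonglongrightarrow> 0" by (intro LIMSEQ_power_zero) simp
  then show ?thesis by (rule Lim_null_comparison[OF ev])
qed

theorem theorem5:
  fixes M :: "'w measure" and T :: "'w \<Rightarrow> real ^ 3 \<Rightarrow> real"
    and C :: "nat \<Rightarrow> real" and K \<alpha> lam :: real
  assumes "gaussian_isotropic_field M C T"
    and "\<And>l. 0 < C l"
    and "0 < K" and "2 < \<alpha>" and "\<And>l. 1 \<le> l \<Longrightarrow> C l \<le> K * real l powr (- \<alpha>)"
    and "0 < lam"
    and "filterlim (\<lambda>l. lam / sqrt (C l)) at_top sequentially"
  shows "(AE \<theta> in lborel. \<theta> \<in> {0..pi} \<longrightarrow>
            (\<forall>\<phi>\<in>{0..<2 * pi}. kappa_ratio M lam T (\<theta>, \<phi>) \<longlonglongrightarrow> 1)) \<and>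
         (\<forall>\<theta>\<in>{0..pi}. \<forall>\<phi>\<in>{0..<2 * pi}. \<forall>b.
            (kappa_ratio M lam T (\<theta>, \<phi>) \<longlongrightarrow> 1)
              (sequentially \<sqinter> principal (regular_degrees b \<theta>)))"
proof -
  obtain a where a: "gaussian_isotropic_coeffs M C a"
      "AE \<omega> in M. residual (T \<omega>) (\<lambda>l m. a l m \<omega>) \<longlonglongrightarrow> 0"
    and M: "prob_space M"
      "(\<lambda>(\<omega>, x). T \<omega> x) \<in> borel_measurable (M \<Otimes>\<^sub>M restrict_space borel (sphere 0 1))"
      "\<And>\<omega>. \<omega> \<in> space M \<Longrightarrow> square_integrable_on_sphere (T \<omega>)"
    using assms(1) unfolding gaussian_isotropic_field_def by blast
  interpret regularized_field M C lam T a
    using M a assms(2,6) by (auto simp: regularized_field_def regularized_field_axioms_def)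
  \<comment> \<open>The restricted limit is proved for every b; the almost-everywhere claim then
    follows from the case b = 1.\<close>
  have lim: "(kappa_ratio M lam T (\<theta>, \<phi>) \<longlongrightarrow> 1) (sequentially \<sqinter> principal (regular_degrees b \<theta>))"
    for \<theta> \<phi> b
  proof (rule tendstoI)
    fix e :: real assume e: "0 < e"
    then obtain K' where K': "0 \<le> K'" "\<And>u w :: real. \<bar>(u + w) ^ 4 - u ^ 4\<bar> \<le> e / 2 * u ^ 4 + K' * w ^ 4"
      using power4_perturbation[of "e / 2"] by auto
    let ?q = "51200 * sqrt (2 * pi) * exp 12"
    \<comment> \<open>The decay of C_l makes s^2 / 10 at least this constant times
      l^\<alpha>.\<close>
    let ?k = "lam\<^sup>2 / (10 * K)"
    have "(\<lambda>l. K' * (?q * exp ((21 + 4 * b) * (real l)\<^sup>2 - ?k * real l powr \<alpha>))) \<longlonglongrightarrow> K' * (?q * 0)"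
      using assms by (intro tendsto_mult tendsto_const exp_quadratic_minus_powr_tendsto_0) auto
    then have "eventually (\<lambda>l. K' * (?q * exp ((21 + 4 * b) * (real l)\<^sup>2 - ?k * real l powr \<alpha>)) < e / 2) sequentially"
      by (rule order_tendstoD) (use e in simp)
    then have "eventually (\<lambda>l. l \<in> regular_degrees b \<theta> \<longrightarrow> dist (kappa_ratio M lam T (\<theta>, \<phi>) l) 1 < e) sequentially"
      using eventually_ge_at_top[of 1]
    proof eventually_elim
      case (elim l)
      show ?case
      proof
        assume l: "l \<in> regular_degrees b \<theta>"
        have "C l * real l powr \<alpha> \<le> K * real l powr (- \<alpha>) * real l powr \<alpha>"
          using assms(5) elim by (intro mult_right_mono) auto
        also have "\<dots> = K" using elim by (simp add: powr_minus)
        finally have "C l * real l powr \<alpha> \<le> K" .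
        then have "?k * real l powr \<alpha> \<le> (lam / sqrt (C l))\<^sup>2 / 10"
          using assms(2)[of l] assms(3,6) by (simp add: power_divide field_simps)
        then have "K' * (?q * exp ((21 + 4 * b) * (real l)\<^sup>2 - (lam / sqrt (C l))\<^sup>2 / 10))
          \<le> K' * (?q * exp ((21 + 4 * b) * (real l)\<^sup>2 - ?k * real l powr \<alpha>))"
          using K'(1) by (intro mult_left_mono) auto
        with kappa_ratio_bound[OF K'(2,1) l, of \<phi>] elim(1)
        show "dist (kappa_ratio M lam T (\<theta>, \<phi>) l) 1 < e" by linarith
      qed
    qed
    then show "\<forall>\<^sub>F l in sequentially \<sqinter> principal (regular_degrees b \<theta>). dist (kappa_ratio M lam T (\<theta>, \<phi>) l) 1 < e"
      by (simp add: eventually_inf_principal)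
  qed
  have "AE \<theta> in lborel. \<theta> \<in> {0..pi} \<longrightarrow> (\<forall>\<phi>\<in>{0..<2 * pi}. kappa_ratio M lam T (\<theta>, \<phi>) \<longlonglongrightarrow> 1)"
    using AE_regular_degrees
  proof eventually_elim
    case (elim \<theta>)
    show ?case
    proof (intro impI ballI)
      fix \<phi> assume "\<theta> \<in> {0..pi}"
      \<comment> \<open>All large degrees are regular at this angle, so restricting the filter
        changes nothing.\<close>
      with elim have "sequentially \<sqinter> principal (regular_degrees 1 \<theta>) = sequentially"
        by (simp add: inf_absorb1 le_principal)
      with lim[of \<theta> \<phi> 1] show "kappa_ratio M lam T (\<theta>, \<phi>) \<longlonglongrightarrow> 1" by simp
    qed
  qed
  with lim show ?thesis by blast
qed

end
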